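(* In the message-passing model with $s$ players and no edge duplication, the randomized communication complexity of computing an additive $k$-spanner of an $n$-vertex input graph is $\tilde O\big(\sqrt{s/k}\, n^{3/2}+snk\big)$ bits.
   Context: Message-passing model: there are $s$ players $P^1,\dots,P^s$ and a coordinator. All parties know the vertex set $V$, $|V|=n$; player $P^i$ holds an edge set $E_i$ on $V$, and the input graph is $G=(V,\bigcup_i E_i)$ (unweighted, undirected). Communication is only between the coordinator and individual players; the coordinator must output the spanner. Communication cost is the total number of bits exchanged; randomized protocols must succeed with constant probability (at least $2/3$) on every input. "No edge duplication" means the $E_i$ are pairwise disjoint. An additive $k$-spanner of $G$ ($k\ge 2$ an integer) is a subgraph $H$ with $d_G(u,v)\le d_H(u,v)\le d_G(u,v)+k$ for all $u,v$. $\tilde O$ hides $\mathrm{poly}(\log n)$ factors. Standing assumption: $s\ll n$. *)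

theory Defs
  imports "HOL-Probability.Probability" "HOL-Probability.Product_PMF"
begin

section \<open>Additive spanners\<close>

text \<open>Graphs have vertex set \<open>{..<n}\<close> and are given by their set of edges, an edge being a
  two-element set of vertices.\<close>

definition simple_edges :: "nat \<Rightarrow> nat set set" where
  "simple_edges n = {{u, v} | u v. u < n \<and> v < n \<and> u \<noteq> v}"

definition adjacency :: "nat set set \<Rightarrow> nat rel" where
  "adjacency E = {(u, v). {u, v} \<in> E}"

text \<open>Length of a shortest walk; \<open>\<infinity>\<close> if there is none.\<close>

definition graph_dist :: "nat set set \<Rightarrow> nat \<Rightarrow> nat \<Rightarrow> enat" where
  "graph_dist E u v = (INF l \<in> {l. (u, v) \<in> adjacency E ^^ l}. enat l)"

definition additive_spanner :: "nat \<Rightarrow> nat \<Rightarrow> nat set set \<Rightarrow> nat set set \<Rightarrow> bool" where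
  "additive_spanner n k E H \<longleftrightarrow>
     H \<subseteq> E \<and>
     (\<forall>u<n. \<forall>v<n. graph_dist E u v \<le> graph_dist H u v \<and>
                    graph_dist H u v \<le> graph_dist E u v + enat k)"


section \<open>Randomized protocols in the message-passing model\<close>

text \<open>
  There are players \<open>0, \<dots>, s - 1\<close>, each connected to the coordinator by its own channel.
  Communication is bit by bit, so that no information can be hidden in message lengths or in
  empty messages. The direction of the next bit on channel \<open>i\<close> (\<open>player_turn\<close>) is a function of
  the bits already exchanged on that channel, and hence known to both of its ends.
  The coordinator decides which channel is used next, based on its coins and on the whole
  transcript; in \<open>Exchange i b\<close> the bit \<open>b\<close> is the one it sends, and \<open>b\<close> is ignored if it is
  the player's turn on channel \<open>i\<close>. A player sees only its input, its coins and the bits on its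
  own channel. All coins are private; a party's coins are a sample from an arbitrary discrete
  distribution.
\<close>

datatype 'out action = Exchange nat bool | Output 'out

type_synonym transcript = "(nat \<times> bool) list"

definition channel :: "nat \<Rightarrow> transcript \<Rightarrow> bool list" where
  "channel i t = map snd (filter (\<lambda>p. fst p = i) t)"

record ('inp, 'out) protocol =
  coord_coins :: "nat pmf"
  player_coins :: "nat \<Rightarrow> nat pmf"
  player_turn :: "nat \<Rightarrow> bool list \<Rightarrow> bool"
  player_bit :: "nat \<Rightarrow> 'inp \<Rightarrow> nat \<Rightarrow> bool list \<Rightarrow> bool"
  coord_action :: "nat \<Rightarrow> transcript \<Rightarrow> 'out action"

definition well_formed_protocol :: "nat \<Rightarrow> ('inp, 'out) protocol \<Rightarrow> bool" where
  "well_formed_protocol s P \<longleftrightarrow>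
     (\<forall>c t i b. coord_action P c t = Exchange i b \<longrightarrow> i < s)"

text \<open>The transcript after at most \<open>m\<close> bits, for inputs \<open>x\<close>, coordinator coins \<open>c\<close> and player
  coins \<open>r\<close>.\<close>

primrec run ::
    "('inp, 'out) protocol \<Rightarrow> (nat \<Rightarrow> 'inp) \<Rightarrow> nat \<Rightarrow> (nat \<Rightarrow> nat) \<Rightarrow> nat \<Rightarrow> transcript" where
  "run P x c r 0 = []"
| "run P x c r (Suc m) =
     (let t = run P x c r m in
      case coord_action P c t of
        Output y \<Rightarrow> t
      | Exchange i b \<Rightarrow>
          t @ [(i, if player_turn P i (channel i t)
                   then player_bit P i (x i) (r i) (channel i t) else b)])"

text \<open>The coordinator stops with output \<open>y\<close> after at most \<open>m\<close> bits have been exchanged.\<close>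

definition outputs_within ::
    "('inp, 'out) protocol \<Rightarrow> (nat \<Rightarrow> 'inp) \<Rightarrow> nat \<Rightarrow> (nat \<Rightarrow> nat) \<Rightarrow> nat \<Rightarrow> 'out \<Rightarrow> bool" where
  "outputs_within P x c r m y \<longleftrightarrow> coord_action P c (run P x c r m) = Output y"

definition coins :: "nat \<Rightarrow> ('inp, 'out) protocol \<Rightarrow> (nat \<times> (nat \<Rightarrow> nat)) pmf" where
  "coins s P = pair_pmf (coord_coins P) (Pi_pmf {..<s} 0 (player_coins P))"

text \<open>Cost at most \<open>m\<close> is worst case over the admissible inputs \<open>X\<close> and over the coins.\<close>

definition cost_at_most ::
    "nat \<Rightarrow> (nat \<Rightarrow> 'inp) set \<Rightarrow> ('inp, 'out) protocol \<Rightarrow> nat \<Rightarrow> bool" where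
  "cost_at_most s X P m \<longleftrightarrow>
     (\<forall>x\<in>X. \<forall>(c, r)\<in>set_pmf (coins s P). \<exists>y. outputs_within P x c r m y)"

definition solves ::
    "nat \<Rightarrow> (nat \<Rightarrow> 'inp) set \<Rightarrow> ((nat \<Rightarrow> 'inp) \<Rightarrow> 'out \<Rightarrow> bool) \<Rightarrow>
     ('inp, 'out) protocol \<Rightarrow> bool" where
  "solves s X correct P \<longleftrightarrow>
     (\<forall>x\<in>X. measure_pmf.prob (coins s P)
        {(c, r). \<exists>m y. outputs_within P x c r m y \<and> correct x y} \<ge> 2 / 3)"

text \<open>\<open>\<infinity>\<close> if no protocol of bounded cost solves the problem.\<close>

definition randomized_cc ::
    "nat \<Rightarrow> (nat \<Rightarrow> 'inp) set \<Rightarrow> ((nat \<Rightarrow> 'inp) \<Rightarrow> 'out \<Rightarrow> bool) \<Rightarrow> enat" where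
  "randomized_cc s X correct =
     (INF m \<in> {m. \<exists>P. well_formed_protocol s P \<and> solves s X correct P \<and> cost_at_most s X P m}.
        enat m)"


section \<open>Computing additive spanners without edge duplication\<close>

definition disjoint_edge_inputs :: "nat \<Rightarrow> nat \<Rightarrow> (nat \<Rightarrow> nat set set) set" where
  "disjoint_edge_inputs s n =
     {E. (\<forall>i<s. E i \<subseteq> simple_edges n) \<and> disjoint_family_on E {..<s}}"

definition additive_spanner_cc :: "nat \<Rightarrow> nat \<Rightarrow> nat \<Rightarrow> enat" where
  "additive_spanner_cc s n k =
     randomized_cc s (disjoint_edge_inputs s n)
       (\<lambda>E H. additive_spanner n k (\<Union>i<s. E i) H)"

end

theory Submission
  imports Defs
begin

text \<open>
  Choose \<open>L\<close> with \<open>n < 2 ^ L\<close> and \<open>d\<close> about \<open>sqrt (s n / k)\<close>. The spanner consists of all edges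
  at vertices of degree less than \<open>d\<close>, of a \<open>2 L\<close>-multiplicative spanner with at most \<open>2 n\<close>
  edges of every \<open>E i\<close>, and of breadth-first search trees at about \<open>n L\<^sup>2 / (k d)\<close> random roots. As
  no edge is held twice, degrees are sums over the players and the first part has at most \<open>n d\<close> edges.
  If a shortest path misses at most \<open>k / (2 L)\<close> of its edges, then detours through the multiplicative
  spanners lengthen it by at most \<open>k\<close>. Otherwise its neighbourhood has more than \<open>k d / (6 L)\<close>
  vertices, so with good probability it contains a root, and the path through that root in its tree
  is longer by at most \<open>2\<close>. A search tree costs \<open>O(s n)\<close> words of \<open>O(L)\<close> bits.
\<close>

section \<open>Protocols exchanging words\<close>

text \<open>The multiplicative spanners are what brings \<open>k\<close> into the denominator.
  Without them a single missing edge could force a long detour, and the roots would have to hit the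
  neighbourhood of every vertex of degree at least \<open>d\<close>. With them about
  \<open>k / (2 * L)\<close> missing edges are tolerated, so the sets to be hit are larger by that
  factor up to a constant, and the number of roots falls by it. They need no interaction: every edge
  is stretched inside the spanner of its holder. The threshold \<open>d\<close> balances the two
  main costs, up to logarithms: \<open>n * d\<close> words for edges at light vertices against
  \<open>s * n * (n / (k * d))\<close> words for trees. Equality at \<open>d ^ 2 = s * n / k\<close>
  makes both \<open>sqrt (s / k) * n powr (3 / 2)\<close>. Two features of the model shape the
  development. Players do not see each other's channels, so every tree label has to be sent to all
  of them. The cost is worst case over the coins, so the number of roots is fixed, and a bad draw
  may spoil the output but never the length of the run.\<close>

datatype ('q, 'a, 'o) strategy = Return 'o | Ask nat 'q "'a \<Rightarrow> ('q, 'a, 'o) strategy"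

text \<open>\<open>upd\<close> depends on neither input nor answer, so the state of a player is a
  function of the queries on its channel, and the coordinator can always know it. Queries and
  answers get the same width, which makes a round exactly \<open>2 * W\<close> bits.\<close>

locale word_protocol =
  fixes s W :: nat and Q :: "'q set" and A :: "'a set"
    and init :: "'st" and upd :: "'st \<Rightarrow> 'q \<Rightarrow> 'st" and ans :: "'inp \<Rightarrow> 'st \<Rightarrow> 'q \<Rightarrow> 'a"
  assumes s_pos: "0 < s" and W_pos: "0 < W"
    and finite_Q: "finite Q" and card_Q: "card Q \<le> 2 ^ W"
    and finite_A: "finite A" and card_A: "card A \<le> 2 ^ W"
begin

text \<open>A total correctness judgement with \<open>c\<close> as a budget of rounds. The input
  \<open>x\<close> is fixed, so legality of queries and answers is demanded only along the run that
  actually occurs.\<close>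

primrec achieves ::
    "(nat \<Rightarrow> 'inp) \<Rightarrow> ('o \<Rightarrow> bool) \<Rightarrow> ('q, 'a, 'o) strategy \<Rightarrow> (nat \<Rightarrow> 'st) \<Rightarrow> nat \<Rightarrow> bool" where
  "achieves x post (Return y) st c \<longleftrightarrow> post y"
| "achieves x post (Ask i q f) st c \<longleftrightarrow>
     i < s \<and> q \<in> Q \<and> ans (x i) (st i) q \<in> A \<and> 0 < c \<and>
     achieves x post (f (ans (x i) (st i) q)) (st(i := upd (st i) q)) (c - 1)"

definition enc_query :: "'q \<Rightarrow> bool list" where
  "enc_query = (SOME f. inj_on f Q \<and> f ` Q \<subseteq> {bs. length bs = W})"

definition dec_query :: "bool list \<Rightarrow> 'q" where
  "dec_query = inv_into Q enc_query"

definition enc_answer :: "'a \<Rightarrow> bool list" where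
  "enc_answer = (SOME f. inj_on f A \<and> f ` A \<subseteq> {bs. length bs = W})"

definition dec_answer :: "bool list \<Rightarrow> 'a" where
  "dec_answer = inv_into A enc_answer"

text \<open>Words have exactly \<open>W\<close> bits, so that both ends of a channel find the block
  boundaries by counting.\<close>

lemma encoding_exists:
  assumes "finite S" "card S \<le> 2 ^ W"
  shows "\<exists>f. inj_on f S \<and> f ` S \<subseteq> {bs :: bool list. length bs = W}"
proof -
  have fin: "finite {bs :: bool list. length bs = W}"
    using finite_lists_length_eq[of "UNIV :: bool set" W] by simp
  have "card {bs :: bool list. length bs = W} = 2 ^ W"
    using card_lists_length_eq[of "UNIV :: bool set" W] by simp
  with assms fin show ?thesis
    using inj_on_iff_card_le[OF assms(1) fin] by auto
qed

lemma enc_query: "inj_on enc_query Q" "q \<in> Q \<Longrightarrow> length (enc_query q) = W"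
  using someI_ex[OF encoding_exists[OF finite_Q card_Q]] unfolding enc_query_def by auto

lemma enc_answer: "inj_on enc_answer A" "a \<in> A \<Longrightarrow> length (enc_answer a) = W"
  using someI_ex[OF encoding_exists[OF finite_A card_A]] unfolding enc_answer_def by auto

lemma dec_enc [simp]:
  "q \<in> Q \<Longrightarrow> dec_query (enc_query q) = q" "a \<in> A \<Longrightarrow> dec_answer (enc_answer a) = a"
  using enc_query(1) enc_answer(1) by (auto simp: dec_query_def dec_answer_def)

text \<open>On every channel the bits form blocks of length \<open>2 * W\<close>, a query followed by its answer; the
  state of a player is determined by the queries in the completed blocks.\<close>

definition channel_state :: "bool list \<Rightarrow> 'st" where
  "channel_state h =
     foldl (\<lambda>\<sigma> j. upd \<sigma> (dec_query (take W (drop (2 * W * j) h)))) init [0..<length h div (2 * W)]"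

text \<open>The coordinator has no memory: it replays the strategy on the whole transcript, one
  block per round. This works since blocks of different channels do not interleave.
  \<open>i mod s\<close> makes the protocol well formed for every strategy. In the second half of a
  block the index runs past the query word, but then the player speaks and this bit is
  ignored.\<close>

primrec coord_act :: "('q, 'a, 'o) strategy \<Rightarrow> bool list \<Rightarrow> 'o action" where
  "coord_act (Return y) bs = Output y"
| "coord_act (Ask i q f) bs =
     (if length bs < 2 * W then Exchange (i mod s) (enc_query q ! length bs)
      else coord_act (f (dec_answer (take W (drop W bs)))) (drop (2 * W) bs))"

text \<open>Players are deterministic; the only real coins are the coordinator's, and they select
  the strategy. \<open>drop (length h - j) h\<close> is the unfinished block, which begins with the
  query.\<close>

definition protocol_of :: "nat pmf \<Rightarrow> (nat \<Rightarrow> ('q, 'a, 'o) strategy) \<Rightarrow> ('inp, 'o) protocol" where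
  "protocol_of D p =
     \<lparr>coord_coins = D,
      player_coins = (\<lambda>_. return_pmf 0),
      player_turn = (\<lambda>i h. W \<le> length h mod (2 * W)),
      player_bit = (\<lambda>i x r h. let j = length h mod (2 * W) in
        enc_answer (ans x (channel_state h) (dec_query (take W (drop (length h - j) h)))) ! (j - W)),
      coord_action = (\<lambda>c t. coord_act (p c) (map snd t))\<rparr>"

lemma coord_act_lt: "coord_act p bs = Exchange i b \<Longrightarrow> i < s"
  by (induction p arbitrary: bs) (use s_pos in \<open>auto split: if_splits\<close>)

lemma well_formed_protocol_of: "well_formed_protocol s (protocol_of D p)"
  by (auto simp: well_formed_protocol_def protocol_of_def dest: coord_act_lt)

text \<open>Needed while an answer is sent bit by bit: all its bits have to be computed from the
  same state.\<close>

lemma channel_state_partial_block: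
  assumes "2 * W dvd length h" "length u < 2 * W"
  shows "channel_state (h @ u) = channel_state h"
proof -
  obtain m where m: "length h = 2 * W * m" using assms(1) by (auto elim: dvdE)
  have div: "length (h @ u) div (2 * W) = m" "length h div (2 * W) = m"
    using m assms(2) W_pos by (simp_all)
  have "2 * W * j + W \<le> length h" if "j < m" for j
  proof -
    have "2 * W * Suc j \<le> 2 * W * m" using that by (intro mult_le_mono) auto
    then show ?thesis using m by simp
  qed
  then have blocks: "take W (drop (2 * W * j) (h @ u)) = take W (drop (2 * W * j) h)" if "j < m" for j
    using that by fastforce
  show ?thesis unfolding channel_state_def div
    by (intro foldl_cong) (simp_all only: blocks set_upt atLeastLessThan_iff)
qed

lemma channel_state_block:
  assumes "2 * W dvd length h" "length u = 2 * W"
  shows "channel_state (h @ u) = upd (channel_state h) (dec_query (take W u))"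
proof -
  obtain m where m: "length h = 2 * W * m" using assms(1) by (auto elim: dvdE)
  have div: "length (h @ u) div (2 * W) = Suc m" "length h div (2 * W) = m"
    using m assms(2) W_pos by (simp_all)
  have "2 * W * j + W \<le> length h" if "j < m" for j
  proof -
    have "2 * W * Suc j \<le> 2 * W * m" using that by (intro mult_le_mono) auto
    then show ?thesis using m by simp
  qed
  then have blocks: "take W (drop (2 * W * j) (h @ u)) = take W (drop (2 * W * j) h)" if "j < m" for j
    using that by fastforce
  have "foldl (\<lambda>\<sigma> j. upd \<sigma> (dec_query (take W (drop (2 * W * j) (h @ u))))) init [0..<m]
      = channel_state h"
    unfolding channel_state_def div
    by (intro foldl_cong) (simp_all only: blocks set_upt atLeastLessThan_iff)
  then show ?thesis unfolding channel_state_def[of "h @ u"] div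
    using m by simp
qed

lemma channel_append [simp]: "channel i (t @ u) = channel i t @ channel i u"
  by (simp add: channel_def)

lemma channel_map_Pair [simp]: "channel i (map (Pair j) bs) = (if i = j then bs else [])"
  by (induction bs) (auto simp: channel_def)

lemma protocol_of_sel:
  "coord_action (protocol_of D p) c t = coord_act (p c) (map snd t)"
  "player_turn (protocol_of D p) i h \<longleftrightarrow> W \<le> length h mod (2 * W)"
  "player_bit (protocol_of D p) i y b h = (let j = length h mod (2 * W) in
     enc_answer (ans y (channel_state h) (dec_query (take W (drop (length h - j) h)))) ! (j - W))"
  unfolding protocol_of_def protocol.select_convs by (rule refl)+

lemma run_Suc_protocol_of:
  "run (protocol_of D p) x c r (Suc m) =
    (let t = run (protocol_of D p) x c r m in
     case coord_act (p c) (map snd t) of Output y \<Rightarrow> t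
     | Exchange i b \<Rightarrow> let h = channel i t; j = length h mod (2 * W) in
        t @ [(i, if W \<le> j
          then enc_answer (ans (x i) (channel_state h) (dec_query (take W (drop (length h - j) h)))) ! (j - W)
          else b)])"
  unfolding run.simps protocol_of_sel Let_def by (rule refl)

text \<open>Induction on the number of bits of one round. \<open>act\<close> quantifies over all
  continuations because the coordinator decides anew after every bit.\<close>

lemma run_round:
  assumes run: "run (protocol_of D p) x c r m = t"
    and act: "\<And>u. coord_act (p c) (map snd t @ u) = coord_act (Ask i q f) u"
    and chan: "2 * W dvd length (channel i t)"
    and i: "i < s" and q: "q \<in> Q" and a: "a \<in> A" "a = ans (x i) (channel_state (channel i t)) q"
    and j: "j \<le> 2 * W"
  shows "run (protocol_of D p) x c r (m + j) = t @ map (Pair i) (take j (enc_query q @ enc_answer a))"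
  using j
proof (induction j)
  case 0
  then show ?case using run by simp
next
  case (Suc j)
  let ?u = "enc_query q @ enc_answer a"
  let ?h = "channel i t @ take j ?u"
  have len: "length (enc_query q) = W" "length (enc_answer a) = W"
    using enc_query(2) enc_answer(2) q a by auto
  have IH: "run (protocol_of D p) x c r (m + j) = t @ map (Pair i) (take j ?u)"
    using Suc by simp
  have ju: "length (take j ?u) = j" using Suc.prems len by simp
  have mod: "length ?h mod (2 * W) = j"
    using chan Suc.prems ju by auto
  have drop: "drop (length ?h - j) ?h = take j ?u" using ju by simp
  have st: "channel_state ?h = channel_state (channel i t)"
    using channel_state_partial_block[OF chan, of "take j ?u"] ju Suc.prems by simp
  have ca: "coord_act (p c) (map snd (t @ map (Pair i) (take j ?u))) = Exchange i (enc_query q ! j)"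
    using Suc.prems i unfolding map_append map_map comp_def snd_conv map_ident act
    by (simp only: coord_act.simps ju mod_less) simp
  have step: "run (protocol_of D p) x c r (Suc (m + j)) = (t @ map (Pair i) (take j ?u)) @
     [(i, if W \<le> j then enc_answer (ans (x i) (channel_state ?h) (dec_query (take W (take j ?u)))) ! (j - W)
          else enc_query q ! j)]"
    unfolding run_Suc_protocol_of IH Let_def ca action.case channel_append channel_map_Pair
      if_True simp_thms mod drop by simp
  \<comment> \<open>If \<open>W \<le> j\<close>, the first \<open>W\<close> bits of the block are
    the complete query, so the player decodes \<open>q\<close>.\<close>
  have "(if W \<le> j then enc_answer (ans (x i) (channel_state ?h) (dec_query (take W (take j ?u)))) ! (j - W)
          else enc_query q ! j) = ?u ! j"
    using len q a(2) st by (auto simp: nth_append min_def)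
  with step have "run (protocol_of D p) x c r (Suc (m + j)) =
      t @ map (Pair i) (take j ?u @ [?u ! j])" by simp
  also have "take j ?u @ [?u ! j] = take (Suc j) ?u"
    using Suc.prems len by (intro take_Suc_conv_app_nth[symmetric]) simp
  finally show ?case by simp
qed

text \<open>Every \<open>Ask\<close> node adds one full block to a single channel, so between rounds
  all channels consist of complete blocks and encode the current states. The strategy may return
  early, hence a bound on \<open>m'\<close> rather than an equation.\<close>

lemma strategy_simulation:
  assumes "achieves x post p' st N"
    and "run (protocol_of D p) x c r m = t"
    and "\<And>u. coord_act (p c) (map snd t @ u) = coord_act p' u"
    and "\<And>i. i < s \<Longrightarrow> 2 * W dvd length (channel i t) \<and> channel_state (channel i t) = st i"
  shows "\<exists>m'\<le>m + 2 * W * N. \<exists>y. outputs_within (protocol_of D p) x c r m' y \<and> post y"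
  using assms
proof (induction p' arbitrary: st N m t)
  case (Return y)
  have "coord_act (p c) (map snd t) = Output y" using Return.prems(3)[of "[]"] by simp
  then have "outputs_within (protocol_of D p) x c r m y"
    using Return.prems(2) by (simp add: outputs_within_def protocol_of_def)
  then show ?case using Return.prems(1) by (intro exI[of _ m]) auto
next
  case (Ask i q f)
  let ?a = "ans (x i) (st i) q"
  let ?u = "enc_query q @ enc_answer ?a"
  have pr: "i < s" "q \<in> Q" "?a \<in> A" "0 < N"
    "achieves x post (f ?a) (st(i := upd (st i) q)) (N - 1)"
    using Ask.prems(1) by auto
  have len: "length (enc_query q) = W" "length (enc_answer ?a) = W"
    using enc_query(2) enc_answer(2) pr by auto
  have ch: "2 * W dvd length (channel i t)" "channel_state (channel i t) = st i"
    using Ask.prems(4) pr(1) by auto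
  have "run (protocol_of D p) x c r (m + 2 * W) = t @ map (Pair i) (take (2 * W) ?u)"
    by (rule run_round[OF Ask.prems(2,3) ch(1) pr(1,2,3)]) (use ch in auto)
  then have run: "run (protocol_of D p) x c r (m + 2 * W) = t @ map (Pair i) ?u"
    using len by simp
  have act: "coord_act (p c) (map snd (t @ map (Pair i) ?u) @ u) = coord_act (f ?a) u" for u
    using Ask.prems(3)[of "?u @ u"] len pr(3) by (simp add: comp_def)
  have inv: "2 * W dvd length (channel j (t @ map (Pair i) ?u)) \<and>
      channel_state (channel j (t @ map (Pair i) ?u)) = (st(i := upd (st i) q)) j" if "j < s" for j
    using Ask.prems(4)[OF that] channel_state_block[OF ch(1), of ?u] ch len pr(2) by auto
  have "m + 2 * W + 2 * W * (N - 1) = m + 2 * W * N"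
    using pr(4) by (cases N) auto
  then show ?case using Ask.IH[OF _ pr(5) run act inv] by (simp only: rangeI)
qed

lemma outputs_within_mono:
  assumes "outputs_within P x c r m y" "m \<le> m'"
  shows "outputs_within P x c r m' y"
proof -
  have "run P x c r m' = run P x c r m"
    using assms(2,1) by (induction m' rule: dec_induct) (auto simp: outputs_within_def)
  then show ?thesis using assms(1) by (simp add: outputs_within_def)
qed

text \<open>Cost is worst case over the coins while correctness may fail on some of them. Hence the
  conditional postcondition: \<open>N\<close> rounds suffice for every coin in the support, but a
  correct output is owed on good coins only.\<close>

theorem randomized_cc_le:
  fixes D :: "'c :: countable pmf"
  assumes ach: "\<And>x c. x \<in> X \<Longrightarrow> c \<in> set_pmf D \<Longrightarrow>
      achieves x (\<lambda>y. good x c \<longrightarrow> correct x y) (p c) (\<lambda>_. init) N"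
    and prob: "\<And>x. x \<in> X \<Longrightarrow> measure_pmf.prob D {c. good x c} \<ge> 2 / 3"
  shows "randomized_cc s X correct \<le> enat (2 * W * N)"
proof -
  \<comment> \<open>Coins of the model are natural numbers, so the coordinator draws a code of
    \<open>c\<close>.\<close>
  let ?D = "map_pmf to_nat D"
  let ?P = "protocol_of ?D (\<lambda>c. p (from_nat c))"
  have out: "\<exists>y. outputs_within ?P x (to_nat c) r (2 * W * N) y \<and> (good x c \<longrightarrow> correct x y)"
    if "x \<in> X" "c \<in> set_pmf D" for x c r
  proof -
    have "\<exists>m'\<le>0 + 2 * W * N. \<exists>y. outputs_within ?P x (to_nat c) r m' y \<and> (good x c \<longrightarrow> correct x y)"
      by (rule strategy_simulation[OF ach[OF that], where t = "[]"])
        (simp_all add: channel_def channel_state_def)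
    then show ?thesis using outputs_within_mono by fastforce
  qed
  have coins: "coins s ?P = pair_pmf ?D (Pi_pmf {..<s} 0 (\<lambda>_. return_pmf 0))"
    by (simp add: coins_def protocol_of_def)
  have "cost_at_most s X ?P (2 * W * N)"
    unfolding cost_at_most_def coins using out by fastforce
  moreover have "solves s X correct ?P"
    unfolding solves_def
  proof
    fix x assume x: "x \<in> X"
    let ?S = "{(c, r). \<exists>m y. outputs_within ?P x c r m y \<and> correct x y}"
    have "2 / 3 \<le> measure_pmf.prob D ({c. good x c} \<inter> set_pmf D)"
      using prob[OF x] by (simp add: measure_Int_set_pmf)
    \<comment> \<open>A good coordinator coin succeeds with all player coins, which reduces the
      event to the first marginal of \<open>coins\<close>.\<close>
    also have "\<dots> \<le> measure_pmf.prob D (to_nat -` {c. \<forall>r. (c, r) \<in> ?S})"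
      by (rule measure_pmf.finite_measure_mono) (use out[OF x] in fastforce)+
    also have "\<dots> = measure_pmf.prob (map_pmf fst (coins s ?P)) {c. \<forall>r. (c, r) \<in> ?S}"
      by (simp add: coins map_fst_pair_pmf)
    also have "\<dots> = measure_pmf.prob (coins s ?P) (fst -` {c. \<forall>r. (c, r) \<in> ?S})"
      by simp
    also have "\<dots> \<le> measure_pmf.prob (coins s ?P) ?S"
      by (rule measure_pmf.finite_measure_mono) auto
    finally show "2 / 3 \<le> measure_pmf.prob (coins s ?P) ?S" .
  qed
  ultimately show ?thesis
    unfolding randomized_cc_def using well_formed_protocol_of by (intro INF_lower) blast
qed

section \<open>Combinators for collecting answers and broadcasting\<close>

primrec gather :: "(nat \<times> 'q) list \<Rightarrow> ((nat \<Rightarrow> 'q \<Rightarrow> 'a) \<Rightarrow> ('q, 'a, 'o) strategy) \<Rightarrow> ('q, 'a, 'o) strategy" where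
  "gather [] k = k (\<lambda>_ _. undefined)"
| "gather (iq # iqs) k =
     Ask (fst iq) (snd iq) (\<lambda>a. gather iqs (\<lambda>g. k (\<lambda>i q. if (i, q) = iq then a else g i q)))"

text \<open>Gathered queries are required to leave the states unchanged, see
  \<open>achieves_gather\<close>, so any enumeration serves. Working with sets makes the cost a
  cardinality.\<close>

definition gather_set :: "(nat \<times> 'q) set \<Rightarrow> ((nat \<Rightarrow> 'q \<Rightarrow> 'a) \<Rightarrow> ('q, 'a, 'o) strategy) \<Rightarrow> ('q, 'a, 'o) strategy" where
  "gather_set S = gather (SOME iqs. set iqs = S \<and> distinct iqs)"

lemma achieves_gather:
  assumes "\<And>i q. (i, q) \<in> set iqs \<Longrightarrow>
      i < s \<and> q \<in> Q \<and> ans (x i) (st i) q \<in> A \<and> upd (st i) q = st i"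
    and "\<And>g. (\<And>i q. (i, q) \<in> set iqs \<Longrightarrow> g i q = ans (x i) (st i) q) \<Longrightarrow> achieves x post (k g) st N"
  shows "achieves x post (gather iqs k) st (length iqs + N)"
  using assms
proof (induction iqs arbitrary: k)
  case (Cons iq iqs)
  obtain i q where iq: "iq = (i, q)" by force
  have st: "i < s" "q \<in> Q" "ans (x i) (st i) q \<in> A" "upd (st i) q = st i"
    using Cons.prems(1)[of i q] iq by auto
  have "achieves x post (gather iqs (\<lambda>g. k (\<lambda>i' q'. if (i', q') = iq
      then ans (x i) (st i) q else g i' q'))) st (length iqs + N)"
  proof (rule Cons.IH)
    fix g assume "\<And>i q. (i, q) \<in> set iqs \<Longrightarrow> g i q = ans (x i) (st i) q"
    then show "achieves x post (k (\<lambda>i' q'. if (i', q') = iq then ans (x i) (st i) q else g i' q')) st N"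
      using iq by (intro Cons.prems(2)) auto
  qed (use Cons.prems in auto)
  then show ?case using st iq by (simp add: fun_upd_idem)
qed simp

lemma achieves_gather_set:
  assumes "finite S"
    and "\<And>i q. (i, q) \<in> S \<Longrightarrow> i < s \<and> q \<in> Q \<and> ans (x i) (st i) q \<in> A \<and> upd (st i) q = st i"
    and "\<And>g. (\<And>i q. (i, q) \<in> S \<Longrightarrow> g i q = ans (x i) (st i) q) \<Longrightarrow> achieves x post (k g) st N"
  shows "achieves x post (gather_set S k) st (card S + N)"
proof -
  define iqs where "iqs = (SOME iqs. set iqs = S \<and> distinct iqs)"
  have iqs: "set iqs = S" "distinct iqs"
    using someI_ex[OF finite_distinct_list[OF assms(1)]] unfolding iqs_def by auto
  have "achieves x post (gather iqs k) st (length iqs + N)"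
    by (rule achieves_gather) (use assms(2,3) iqs in auto)
  then show ?thesis using distinct_card[OF iqs(2)] by (simp add: gather_set_def iqs_def[symmetric] iqs(1))
qed

primrec broadcast :: "nat list \<Rightarrow> 'q \<Rightarrow> ('q, 'a, 'o) strategy \<Rightarrow> ('q, 'a, 'o) strategy" where
  "broadcast [] q p = p"
| "broadcast (i # is) q p = Ask i q (\<lambda>_. broadcast is q p)"

lemma achieves_broadcast:
  assumes "distinct is" "set is \<subseteq> {..<s}" "q \<in> Q"
    and "\<And>i. i \<in> set is \<Longrightarrow> ans (x i) (st i) q \<in> A"
    and "achieves x post p (\<lambda>i. if i \<in> set is then upd (st i) q else st i) N"
  shows "achieves x post (broadcast is q p) st (length is + N)"
  using assms
proof (induction "is" arbitrary: st)
  case (Cons i "is")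
  have "(\<lambda>j. if j \<in> set is then upd ((st(i := upd (st i) q)) j) q else (st(i := upd (st i) q)) j)
      = (\<lambda>j. if j \<in> set (i # is) then upd (st j) q else st j)"
    using Cons.prems(1) by auto
  then have "achieves x post (broadcast is q p) (st(i := upd (st i) q)) (length is + N)"
    using Cons.prems by (intro Cons.IH) auto
  then show ?case using Cons.prems by simp
qed simp

lemma achieves_mono: "achieves x post p st N \<Longrightarrow> N \<le> N' \<Longrightarrow> achieves x post p st N'"
proof (induction p arbitrary: st N N')
  case (Ask i q f)
  let ?st = "st(i := upd (st i) q)" and ?a = "ans (x i) (st i) q"
  have "achieves x post (f ?a) ?st (N - 1)" using Ask.prems(1) by simp
  then have "achieves x post (f ?a) ?st (N' - 1)"
    by (rule Ask.IH[OF rangeI]) (use Ask.prems(2) in simp)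
  then show ?case using Ask.prems by simp
qed simp

end


section \<open>Distances and spanners\<close>

definition joined :: "nat set set \<Rightarrow> nat \<Rightarrow> nat \<Rightarrow> nat \<Rightarrow> bool" where
  "joined E l u v \<longleftrightarrow> (\<exists>l'\<le>l. (u, v) \<in> adjacency E ^^ l')"

lemma sym_adjacency: "sym (adjacency E)"
  by (auto simp: sym_def adjacency_def insert_commute)

lemma adjacency_mono: "E \<subseteq> F \<Longrightarrow> adjacency E \<subseteq> adjacency F"
  by (auto simp: adjacency_def)

lemma relpow_adjacency_mono:
  assumes "E \<subseteq> F"
  shows "adjacency E ^^ m \<subseteq> adjacency F ^^ m"
  by (induction m) (use adjacency_mono[OF assms] in auto)

lemma joined_refl [simp]: "joined E l u u"
  unfolding joined_def by (rule exI[of _ 0]) simp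

lemma joined_edge: "{u, v} \<in> E \<Longrightarrow> joined E 1 u v"
  unfolding joined_def by (rule exI[of _ 1]) (simp add: adjacency_def)

lemma joined_trans: "joined E l u v \<Longrightarrow> joined E m v w \<Longrightarrow> joined E (l + m) u w"
  unfolding joined_def using relpow_add by (metis add_mono relcompI)

lemma joined_mono: "joined E l u v \<Longrightarrow> E \<subseteq> F \<Longrightarrow> l \<le> m \<Longrightarrow> joined F m u v"
  unfolding joined_def using relpow_adjacency_mono by (meson le_trans subsetD)

lemma joined_commute: "joined E l u v \<longleftrightarrow> joined E l v u"
proof -
  have "(v, u) \<in> adjacency E ^^ m" if "(u, v) \<in> adjacency E ^^ m" for u v m
    using that
  proof (induction m arbitrary: v)
    case (Suc m)
    from Suc.prems obtain y where "(u, y) \<in> adjacency E ^^ m" "(y, v) \<in> adjacency E" by auto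
    then have "(y, u) \<in> adjacency E ^^ m" "(v, y) \<in> adjacency E"
      using Suc.IH symD[OF sym_adjacency] by blast+
    then show ?case by (rule relpow_Suc_I2[rotated])
  qed simp
  then show ?thesis unfolding joined_def by blast
qed

lemma joined_0 [simp]: "joined E 0 u v \<longleftrightarrow> u = v"
  by (auto simp: joined_def)

lemma joined_Suc: "joined E (Suc l) u v \<longleftrightarrow> u = v \<or> (\<exists>w. joined E l u w \<and> {w, v} \<in> E)"
proof
  assume "joined E (Suc l) u v"
  then obtain l' where l': "l' \<le> Suc l" "(u, v) \<in> adjacency E ^^ l'" unfolding joined_def by auto
  then show "u = v \<or> (\<exists>w. joined E l u w \<and> {w, v} \<in> E)"
    unfolding joined_def by (cases l') (auto simp: adjacency_def)
next
  assume "u = v \<or> (\<exists>w. joined E l u w \<and> {w, v} \<in> E)"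
  then show "joined E (Suc l) u v"
    using joined_trans[OF _ joined_edge] by fastforce
qed

text \<open>A nonempty infimum in \<open>enat\<close> is attained. This lets the distance arguments
  run on natural numbers.\<close>

lemma graph_dist_le_iff: "graph_dist E u v \<le> enat l \<longleftrightarrow> joined E l u v"
proof
  assume *: "graph_dist E u v \<le> enat l"
  let ?S = "{l. (u, v) \<in> adjacency E ^^ l}"
  have ne: "?S \<noteq> {}"
  proof
    assume "?S = {}"
    then have "graph_dist E u v = \<infinity>" unfolding graph_dist_def by (simp add: top_enat_def)
    with * show False by simp
  qed
  have "(INF l\<in>?S. enat l) \<in> enat ` ?S"
    unfolding Inf_enat_def using ne LeastI_ex[of "\<lambda>x. x \<in> enat ` ?S"] by auto
  then obtain l' where "(u, v) \<in> adjacency E ^^ l'" "graph_dist E u v = enat l'"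
    unfolding graph_dist_def by blast
  then show "joined E l u v"
    using * unfolding joined_def by (metis enat_ord_simps(1))
next
  assume "joined E l u v"
  then obtain l' where "l' \<le> l" "(u, v) \<in> adjacency E ^^ l'" unfolding joined_def by blast
  then have "graph_dist E u v \<le> enat l'" 
    unfolding graph_dist_def using INF_lower[of l' "{l. (u, v) \<in> adjacency E ^^ l}" enat] by simp
  also have "enat l' \<le> enat l" using \<open>l' \<le> l\<close> by simp
  finally show "graph_dist E u v \<le> enat l" .
qed

text \<open>Removing edges cannot shorten a walk, and a pair at infinite distance imposes nothing;
  so only shortest walks of \<open>E\<close> have to be matched in \<open>H\<close>.\<close>

lemma additive_spannerI:
  assumes "H \<subseteq> E"
    and "\<And>u v l. u < n \<Longrightarrow> v < n \<Longrightarrow> (u, v) \<in> adjacency E ^^ l \<Longrightarrow>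
      (\<And>m. m < l \<Longrightarrow> (u, v) \<notin> adjacency E ^^ m) \<Longrightarrow> joined H (l + k) u v"
  shows "additive_spanner n k E H"
  unfolding additive_spanner_def
proof (intro conjI allI impI)
  fix u v assume uv: "u < n" "v < n"
  show "graph_dist E u v \<le> graph_dist H u v"
  proof (cases "graph_dist H u v")
    case (enat l)
    then have "joined E l u v"
      using joined_mono[OF _ assms(1) order_refl] by (metis graph_dist_le_iff order_refl)
    then show ?thesis using enat graph_dist_le_iff by metis
  qed simp
  show "graph_dist H u v \<le> graph_dist E u v + enat k"
  proof (cases "graph_dist E u v")
    case (enat l)
    then have "joined E l u v" by (metis graph_dist_le_iff order_refl)
    moreover have "\<not> joined E m u v" if "m < l" for m
      using enat that by (metis enat_ord_simps(1) graph_dist_le_iff not_le)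
    ultimately have "(u, v) \<in> adjacency E ^^ l" "\<And>m. m < l \<Longrightarrow> (u, v) \<notin> adjacency E ^^ m"
      unfolding joined_def by (metis order_le_less order_refl)+
    then have "joined H (l + k) u v" using assms(2) uv by blast
    then show ?thesis using enat graph_dist_le_iff by (metis plus_enat_simps(1))
  qed simp
qed (rule assms(1))

text \<open>Ball carving: the balls around a vertex cannot keep doubling, so some ball \<open>S\<close> of radius less
  than \<open>L\<close> has a neighbourhood with at most \<open>2 * card S\<close> vertices. A shortest-path tree of this
  neighbourhood is charged to \<open>S\<close> and takes care of all edges meeting \<open>S\<close>.\<close>

lemma low_stretch_subgraph:
  assumes "finite V" "card V < 2 ^ L" "\<And>e. e \<in> E \<Longrightarrow> \<exists>u\<in>V. \<exists>v\<in>V. e = {u, v}"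
  shows "\<exists>F\<subseteq>E. finite F \<and> card F \<le> 2 * card V \<and> (\<forall>u v. {u, v} \<in> E \<longrightarrow> joined F (2 * L) u v)"
  using assms
proof (induction "card V" arbitrary: V E rule: less_induct)
  case less
  show ?case
  proof (cases "V = {}")
    case True
    then have "E = {}" using less.prems(3) by blast
    then show ?thesis by auto
  next
    case False
    then obtain w where w: "w \<in> V" by blast
    define B where "B r = {x \<in> V. joined E r w x}" for r
    have finB: "finite (B r)" for r using less.prems(1) by (simp add: B_def)
    have BV: "card (B r) \<le> card V" for r
      using less.prems(1) by (intro card_mono) (auto simp: B_def)
    have inV: "u \<in> V" "v \<in> V" if "{u, v} \<in> E" for u v
      using less.prems(3)[OF that] by (auto simp: doubleton_eq_iff)
    have "\<exists>r<L. card (B (Suc r)) \<le> 2 * card (B r)"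
    proof (rule ccontr)
      assume "\<not> ?thesis"
      then have grow: "2 * card (B r) < card (B (Suc r))" if "r < L" for r
        using that by (meson not_le)
      have "2 ^ r \<le> card (B r)" if "r \<le> L" for r
        using that
      proof (induction r)
        case 0
        have "B 0 = {w}" using w by (auto simp: B_def)
        then show ?case by simp
      next
        case (Suc r)
        then show ?case using grow[of r] by simp
      qed
      then have "2 ^ L \<le> card V" using BV[of L] by (meson le_trans order_refl)
      with less.prems(2) show False by simp
    qed
    then obtain r where r: "r < L" "card (B (Suc r)) \<le> 2 * card (B r)" by blast
    \<comment> \<open>A neighbour one step nearer to \<open>w\<close> serves all \<open>l\<close> at
      once, so one parent function describes the tree at every depth.\<close>
    define par where "par x = (SOME p. {p, x} \<in> E \<and> (\<forall>l. joined E (Suc l) w x \<longrightarrow> joined E l w p))" for x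
    define T where "T = (\<lambda>x. {par x, x}) ` (B (Suc r) - {w})"
    have par: "{par x, x} \<in> E \<and> (\<forall>l. joined E (Suc l) w x \<longrightarrow> joined E l w (par x))"
      if ne: "x \<noteq> w" and l: "joined E l w x" for x l
    proof -
      define d where "d = (LEAST l. joined E l w x)"
      have d: "joined E d w x" unfolding d_def using l by (rule LeastI)
      then obtain d' where d': "d = Suc d'" using ne d by (cases d) auto
      then obtain p where p: "joined E d' w p" "{p, x} \<in> E"
        using d ne by (auto simp: joined_Suc)
      have "joined E l w p" if "joined E (Suc l) w x" for l
      proof -
        have "d \<le> Suc l" unfolding d_def using that by (rule Least_le)
        then show ?thesis using p(1) d' joined_mono by blast
      qed
      then have "\<exists>p. {p, x} \<in> E \<and> (\<forall>l. joined E (Suc l) w x \<longrightarrow> joined E l w p)" using p by blast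
      from someI_ex[OF this] show ?thesis unfolding par_def .
    qed
    have TE: "T \<subseteq> E"
    proof
      fix e assume "e \<in> T"
      then obtain x where "x \<noteq> w" "joined E (Suc r) w x" "e = {par x, x}"
        by (auto simp: T_def B_def)
      then show "e \<in> E" using par by blast
    qed
    have T_joined: "joined T l w x" if "joined E l w x" "l \<le> Suc r" for l x
      using that
    proof (induction l arbitrary: x)
      case (Suc l)
      show ?case
      proof (cases "x = w")
        case False
        note p = par[OF False Suc.prems(1)]
        then have "joined T l w (par x)" using Suc by auto
        moreover have "x \<in> B (Suc r)"
          using p inV(2) joined_mono[OF Suc.prems(1) order_refl Suc.prems(2)] by (auto simp: B_def)
        then have "{par x, x} \<in> T" using False by (auto simp: T_def)
        ultimately show ?thesis by (auto simp: joined_Suc)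
      qed simp
    qed simp
    have card_T: "card T \<le> 2 * card (B r)" and finT: "finite T"
    proof -
      have "card T \<le> card (B (Suc r) - {w})" unfolding T_def using finB by (intro card_image_le) auto
      also have "\<dots> \<le> card (B (Suc r))" using finB by (intro card_mono) auto
      finally show "card T \<le> 2 * card (B r)" using r(2) by simp
      show "finite T" unfolding T_def using finB by auto
    qed
    define E' where "E' = {e \<in> E. e \<inter> B r = {}}"
    have "w \<in> B r" using w by (simp add: B_def)
    then have psub: "card (V - B r) < card V"
      using w less.prems(1) by (intro psubset_card_mono) auto
    have E': "\<exists>u\<in>V - B r. \<exists>v\<in>V - B r. e = {u, v}" if "e \<in> E'" for e
      using that less.prems(3)[of e] by (auto simp: E'_def)
    \<comment> \<open>\<open>L\<close> is kept while the vertex set shrinks, so the stretch does not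
      degrade in the recursion.\<close>
    have "finite (V - B r)" "card (V - B r) < 2 ^ L" using psub less.prems(1,2) by simp_all
    then have "\<exists>F\<subseteq>E'. finite F \<and> card F \<le> 2 * card (V - B r) \<and>
        (\<forall>u v. {u, v} \<in> E' \<longrightarrow> joined F (2 * L) u v)"
      using E' by (intro less.hyps[OF psub])
    then obtain F where F: "F \<subseteq> E'" "finite F" "card F \<le> 2 * card (V - B r)"
      "\<And>u v. {u, v} \<in> E' \<Longrightarrow> joined F (2 * L) u v" by auto
    show ?thesis
    proof (intro exI[of _ "T \<union> F"] conjI allI impI)
      show "T \<union> F \<subseteq> E" using TE F(1) by (auto simp: E'_def)
      show "finite (T \<union> F)" using finT F(2) by simp
      have "card (V - B r) = card V - card (B r)"
        using less.prems(1) by (intro card_Diff_subset) (auto simp: B_def finB)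
      then show "card (T \<union> F) \<le> 2 * card V"
        using card_Un_le[of T F] card_T F(3) BV[of r] by simp
    next
      fix u v assume uv: "{u, v} \<in> E"
      have near: "joined (T \<union> F) (2 * L) a b" if "a \<in> B r" "{a, b} \<in> E" for a b
      proof -
        have "joined E r w a" using that by (simp add: B_def)
        moreover have "joined E (Suc r) w b" using calculation that(2) by (auto simp: joined_Suc)
        ultimately have "joined T r w a" "joined T (Suc r) w b" using T_joined by auto
        \<comment> \<open>Up to the root \<open>w\<close> and down again; \<open>r < L\<close> turns
          this into at most \<open>2 * L\<close>.\<close>
        then have "joined T (r + Suc r) a b"
          using joined_trans joined_commute by metis
        then show ?thesis by (rule joined_mono) (use r(1) in auto)
      qed
      show "joined (T \<union> F) (2 * L) u v"
      proof (cases "{u, v} \<in> E'")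
        case True
        then show ?thesis using F(4) joined_mono by (metis Un_upper2 order_refl)
      next
        case False
        then have "u \<in> B r \<or> v \<in> B r" using uv by (auto simp: E'_def)
        then show ?thesis using near uv joined_commute by (metis insert_commute)
      qed
    qed
  qed
qed

section \<open>Neighbourhoods of shortest paths\<close>

definition nbrs :: "nat set set \<Rightarrow> nat \<Rightarrow> nat set" where
  "nbrs E v = {z. {v, z} \<in> E}"

lemma edge_in_simple_edges: "E \<subseteq> simple_edges n \<Longrightarrow> {u, v} \<in> E \<Longrightarrow> u < n \<and> v < n \<and> u \<noteq> v"
  by (drule (1) subsetD) (auto simp: simple_edges_def doubleton_eq_iff)

lemma nbrs_subset: "E \<subseteq> simple_edges n \<Longrightarrow> nbrs E v \<subseteq> {..<n}"
  using edge_in_simple_edges by (auto simp: nbrs_def)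

lemma finite_nbrs: "E \<subseteq> simple_edges n \<Longrightarrow> finite (nbrs E v)"
  by (erule finite_subset[OF nbrs_subset]) simp

lemma joined_path:
  assumes "\<And>j. j < l \<Longrightarrow> {x j, x (Suc j)} \<in> E" "i \<le> j" "j \<le> l"
  shows "joined E (j - i) (x i) (x j)"
  using assms(2,3)
proof (induction j rule: dec_induct)
  case (step j)
  then have "joined E (j - i) (x i) (x j)" "{x j, x (Suc j)} \<in> E" using assms(1) by auto
  then show ?case using step by (auto simp: Suc_diff_le joined_Suc)
qed simp

text \<open>A path with \<open>M\<close> edges outside \<open>H\<close> is lengthened by at most \<open>2 * L * M\<close>. So if this is too
  much, then \<open>M\<close> is large. Missing edges start at vertices of degree at least \<open>d\<close>, and no vertex is
  adjacent to more than three vertices of a shortest path.\<close>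

lemma card_path_nbhd:
  assumes E: "E \<subseteq> simple_edges n"
    and light: "\<And>u v. {u, v} \<in> E \<Longrightarrow> card (nbrs E u) < d \<Longrightarrow> {u, v} \<in> H"
    and stretch: "\<And>u v. {u, v} \<in> E \<Longrightarrow> joined H (2 * L) u v"
    and path: "\<And>j. j < l \<Longrightarrow> {x j, x (Suc j)} \<in> E"
    and shortest: "\<And>m. joined E m (x 0) (x l) \<Longrightarrow> l \<le> m"
    and far: "\<not> joined H (l + k) (x 0) (x l)"
    and d: "0 < d"
  shows "k * d < 6 * L * card (\<Union>j\<le>l. nbrs E (x j))"
proof -
  define J where "J m = {j. j < m \<and> {x j, x (Suc j)} \<notin> H}" for m
  let ?N = "\<Union>j\<le>l. nbrs E (x j)"
  have finN: "finite ?N" using finite_nbrs[OF E] by auto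
  have finJ: "finite (J m)" for m by (simp add: J_def)
  have len: "joined H (m + 2 * L * card (J m)) (x 0) (x m)" if "m \<le> l" for m
    using that
  proof (induction m)
    case (Suc m)
    then have IH: "joined H (m + 2 * L * card (J m)) (x 0) (x m)" by simp
    show ?case
    proof (cases "{x m, x (Suc m)} \<in> H")
      case True
      then have "J (Suc m) = J m" by (auto simp: J_def less_Suc_eq)
      then show ?thesis using IH True by (auto simp: joined_Suc)
    next
      case False
      then have "J (Suc m) = insert m (J m)" "m \<notin> J m" by (auto simp: J_def less_Suc_eq)
      then have "card (J (Suc m)) = Suc (card (J m))" using finJ by simp
      moreover have "joined H (m + 2 * L * card (J m) + 2 * L) (x 0) (x (Suc m))"
        using joined_trans[OF IH stretch] path Suc by auto
      ultimately show ?thesis using joined_mono[OF _ order_refl] by simp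
    qed
  qed simp
  have "k < 2 * L * card (J l)"
    using len[of l] far joined_mono[OF _ order_refl, of H "l + 2 * L * card (J l)" "x 0" "x l" "l + k"]
    by force
  then have 1: "k * d < 2 * L * (card (J l) * d)" using d by (simp add: mult.assoc[symmetric])
  have heavy: "d \<le> card (nbrs E (x j))" if "j \<in> J l" for j
    using that light[of "x j" "x (Suc j)"] path by (force simp: J_def)
  \<comment> \<open>Pairs of a position in \<open>J l\<close> and a neighbour of its vertex are
    counted in two ways: a position has at least \<open>d\<close> neighbours, and a neighbour serves
    at most 3 positions.\<close>
  have "card (J l) * d \<le> (\<Sum>j\<in>J l. card (nbrs E (x j)))"
    using sum_bounded_below[of "J l" d] heavy by simp
  also have "\<dots> = card (SIGMA j:J l. nbrs E (x j))"
    using finJ finite_nbrs[OF E] by (subst card_SigmaI) auto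
  also have "\<dots> = card (prod.swap ` (SIGMA j:J l. nbrs E (x j)))"
    by (rule card_image[symmetric]) (auto intro: inj_onI)
  also have "\<dots> \<le> card (SIGMA z:?N. {j \<in> J l. {x j, z} \<in> E})"
    by (rule card_mono) (use finN finJ in \<open>auto simp: nbrs_def J_def intro!: finite_SigmaI intro: less_imp_le\<close>)
  also have "\<dots> = (\<Sum>z\<in>?N. card {j \<in> J l. {x j, z} \<in> E})"
    using finN finJ by (subst card_SigmaI) auto
  also have "\<dots> \<le> (\<Sum>z\<in>?N. 3)"
  proof (rule sum_mono)
    fix z
    let ?I = "{j \<in> J l. {x j, z} \<in> E}"
    show "card ?I \<le> 3"
    proof (cases "?I = {}")
      case False
      define i where "i = Min ?I"
      have i: "i \<in> ?I" unfolding i_def using False finJ by (intro Min_in) auto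
      \<comment> \<open>Vertices with the common neighbour \<open>z\<close> have distance at most 2,
        hence their positions on a shortest path differ by at most 2.\<close>
      have "?I \<subseteq> {i..i + 2}"
      proof
        fix j assume j: "j \<in> ?I"
        then have "i \<le> j" unfolding i_def using finJ by (intro Min_le) auto
        have le: "i \<le> l" "j \<le> l" using i j by (auto simp: J_def)
        have "joined E 1 (x i) z" "joined E 1 z (x j)"
          using i j joined_edge by (auto simp: insert_commute)
        then have "joined E (1 + 1) (x i) (x j)" by (rule joined_trans)
        then have "joined E 2 (x i) (x j)" by (simp only: one_add_one)
        moreover have "joined E i (x 0) (x i)" "joined E (l - j) (x j) (x l)"
          using joined_path[of l x E 0 i] joined_path[of l x E j l] path le by auto
        ultimately have "joined E (i + 2 + (l - j)) (x 0) (x l)"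
          using joined_trans by blast
        then have "l \<le> i + 2 + (l - j)" by (rule shortest)
        then show "j \<in> {i..i + 2}" using \<open>i \<le> j\<close> le by auto
      qed
      then have "card ?I \<le> card {i..i + 2}" by (intro card_mono) auto
      then show ?thesis by simp
    qed (simp only: card.empty)
  qed
  finally have "card (J l) * d \<le> card ?N * 3" by simp
  then have "2 * L * (card (J l) * d) \<le> 2 * L * (card ?N * 3)" by (rule mult_le_mono2)
  also have "\<dots> = 6 * L * card ?N" by simp
  finally show ?thesis using 1 by (rule less_le_trans[rotated])
qed

text \<open>One shortest path is fixed for each pair, depending on the graph alone. Thus only
  \<open>n * n\<close> sets have to be hit, and they are fixed before the roots are drawn. For
  unconnected pairs the choice is meaningless.\<close>

definition geodesic :: "nat set set \<Rightarrow> nat \<Rightarrow> nat \<Rightarrow> nat \<Rightarrow> nat" where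
  "geodesic E u v = (SOME x. x 0 = u \<and> x (LEAST l. (u, v) \<in> adjacency E ^^ l) = v \<and>
     (\<forall>j < (LEAST l. (u, v) \<in> adjacency E ^^ l). {x j, x (Suc j)} \<in> E))"

definition geodesic_nbhd :: "nat set set \<Rightarrow> nat \<Rightarrow> nat \<Rightarrow> nat set" where
  "geodesic_nbhd E u v = (\<Union>j\<le>(LEAST l. (u, v) \<in> adjacency E ^^ l). nbrs E (geodesic E u v j))"

lemma geodesic_nbhd_subset: "E \<subseteq> simple_edges n \<Longrightarrow> geodesic_nbhd E u v \<subseteq> {..<n}"
  unfolding geodesic_nbhd_def using nbrs_subset by blast

theorem additive_spanner_if_hitting:
  assumes E: "E \<subseteq> simple_edges n" and H: "H \<subseteq> E"
    and light: "\<And>u v. {u, v} \<in> E \<Longrightarrow> card (nbrs E u) < d \<Longrightarrow> {u, v} \<in> H"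
    and stretch: "\<And>u v. {u, v} \<in> E \<Longrightarrow> joined H (2 * L) u v"
    and trees: "\<And>w v l. w \<in> C \<Longrightarrow> joined E l w v \<Longrightarrow> joined H l w v"
    and hitting: "\<And>u v. u < n \<Longrightarrow> v < n \<Longrightarrow> k * d < 6 * L * card (geodesic_nbhd E u v) \<Longrightarrow>
      C \<inter> geodesic_nbhd E u v \<noteq> {}"
    and d: "0 < d" and k: "2 \<le> k"
  shows "additive_spanner n k E H"
proof (rule additive_spannerI[OF H], rule ccontr)
  fix u v l
  assume uv: "u < n" "v < n" and l: "(u, v) \<in> adjacency E ^^ l"
    and min: "\<And>m. m < l \<Longrightarrow> (u, v) \<notin> adjacency E ^^ m" and far: "\<not> joined H (l + k) u v"
  let ?x = "geodesic E u v"
  have Least: "(LEAST l. (u, v) \<in> adjacency E ^^ l) = l"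
    using l min by (intro Least_equality) (auto simp: not_less[symmetric])
  have "\<exists>x. x 0 = u \<and> x l = v \<and> (\<forall>j<l. {x j, x (Suc j)} \<in> E)"
    using l by (auto simp: relpow_fun_conv adjacency_def)
  from someI_ex[OF this]
  have x: "?x 0 = u" "?x l = v" "\<And>j. j < l \<Longrightarrow> {?x j, ?x (Suc j)} \<in> E"
    unfolding geodesic_def Least by auto
  have short: "l \<le> m" if "joined E m (?x 0) (?x l)" for m
    using that min x(1,2) unfolding joined_def by (metis le_trans not_less)
  have nb: "geodesic_nbhd E u v = (\<Union>j\<le>l. nbrs E (?x j))"
    unfolding geodesic_nbhd_def Least ..
  have "k * d < 6 * L * card (geodesic_nbhd E u v)"
    unfolding nb by (rule card_path_nbhd[where x = ?x, OF E light stretch x(3) short]) (use far x d in auto)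
  then obtain z j where z: "z \<in> C" "j \<le> l" "{?x j, z} \<in> E"
    using hitting[OF uv] by (auto simp: nb nbrs_def)
  have "joined E j u (?x j)" "joined E (l - j) (?x j) v"
    using joined_path[of l ?x E 0 j] joined_path[of l ?x E j l] x z(2) by auto
  moreover have "joined E 1 (?x j) z" "joined E 1 z (?x j)"
    using joined_edge[OF z(3)] joined_commute by auto
  ultimately have "joined E (j + 1) u z" "joined E (1 + (l - j)) z v" using joined_trans by blast+
  then have "joined H (j + 1) u z" "joined H (1 + (l - j)) z v"
    using trees[OF z(1)] joined_commute by metis+
  \<comment> \<open>This length is \<open>l + 2\<close>, which \<open>2 \<le> k\<close>
    allows.\<close>
  then have "joined H (j + 1 + (1 + (l - j))) u v" by (rule joined_trans)
  then have "joined H (l + k) u v" by (rule joined_mono) (use z(2) k in auto)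
  with far show False ..
qed

text \<open>Drawing a uniform list is sampling with replacement: the share of lists that avoid
  \<open>S i\<close> is the power \<open>R\<close> of \<open>1 - card (S i) / card V\<close>, at
  most the exponential in \<open>R\<close>. A union bound over \<open>I\<close> finishes.\<close>

theorem hitting_set_probability:
  fixes V :: "'v set" and S :: "'b \<Rightarrow> 'v set"
  assumes V: "finite V" "V \<noteq> {}" and I: "finite I" and S: "\<And>i. i \<in> I \<Longrightarrow> S i \<subseteq> V"
    and large: "\<And>i. i \<in> I \<Longrightarrow> \<mu> \<le> real (card (S i))"
    and R: "real (card I) * exp (- (\<mu> * real R / real (card V))) \<le> \<epsilon>"
  shows "measure_pmf.prob (pmf_of_set {ws. set ws \<subseteq> V \<and> length ws = R})
      {ws. \<forall>i\<in>I. set ws \<inter> S i \<noteq> {}} \<ge> 1 - \<epsilon>"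
proof -
  let ?L = "{ws. set ws \<subseteq> V \<and> length ws = R}"
  let ?D = "pmf_of_set ?L"
  let ?n = "card V"
  have finL: "finite ?L" using V(1) by (rule finite_lists_length_eq)
  have n: "0 < ?n" using V by (simp add: card_gt_0_iff)
  have cardL: "card ?L = ?n ^ R" using V(1) by (rule card_lists_length_eq)
  then have neL: "?L \<noteq> {}" using n by (metis card.empty not_less0 zero_less_power)
  have miss: "measure_pmf.prob ?D {ws. set ws \<inter> S i = {}} \<le> exp (- (\<mu> * real R / real ?n))"
    if i: "i \<in> I" for i
  proof -
    have eq: "?L \<inter> {ws. set ws \<inter> S i = {}} = {ws. set ws \<subseteq> V - S i \<and> length ws = R}" by auto
    have finS: "finite (S i)" using S[OF i] V(1) finite_subset by blast
    have c: "card (V - S i) = ?n - card (S i)" "card (S i) \<le> ?n"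
      using S[OF i] V(1) finS by (auto intro: card_Diff_subset card_mono)
    have "measure_pmf.prob ?D {ws. set ws \<inter> S i = {}} = real (card (V - S i) ^ R) / real (?n ^ R)"
      unfolding measure_pmf_of_set[OF neL finL] eq cardL using V(1) by (subst card_lists_length_eq) auto
    also have "\<dots> = (1 - real (card (S i)) / real ?n) ^ R"
      using c n by (simp add: power_divide[symmetric] of_nat_diff diff_divide_distrib)
    also have "\<dots> \<le> (1 - \<mu> / real ?n) ^ R"
      using large[OF i] c n by (intro power_mono) (auto simp: divide_right_mono)
    also have "\<dots> \<le> exp (- (\<mu> / real ?n)) ^ R"
    proof (rule power_mono)
      show "1 - \<mu> / real ?n \<le> exp (- (\<mu> / real ?n))" using exp_ge_add_one_self[of "- (\<mu> / real ?n)"] by simp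
      have "\<mu> \<le> real ?n" using large[OF i] c by linarith
      then show "0 \<le> 1 - \<mu> / real ?n" using n by simp
    qed
    also have "\<dots> = exp (- (\<mu> * real R / real ?n))"
      by (simp add: exp_of_nat_mult[symmetric] algebra_simps)
    finally show ?thesis .
  qed
  have "measure_pmf.prob ?D (\<Union>i\<in>I. {ws. set ws \<inter> S i = {}})
      \<le> (\<Sum>i\<in>I. measure_pmf.prob ?D {ws. set ws \<inter> S i = {}})"
    using I by (intro measure_pmf.finite_measure_subadditive_finite) auto
  also have "\<dots> \<le> real (card I) * exp (- (\<mu> * real R / real ?n))"
    using miss by (rule sum_bounded_above)
  finally have bad: "measure_pmf.prob ?D (\<Union>i\<in>I. {ws. set ws \<inter> S i = {}}) \<le> \<epsilon>" using R by simp
  have "{ws. \<forall>i\<in>I. set ws \<inter> S i \<noteq> {}} = UNIV - (\<Union>i\<in>I. {ws. set ws \<inter> S i = {}})" by auto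
  then have "measure_pmf.prob ?D {ws. \<forall>i\<in>I. set ws \<inter> S i \<noteq> {}}
      = 1 - measure_pmf.prob ?D (\<Union>i\<in>I. {ws. set ws \<inter> S i = {}})"
    using measure_pmf.prob_compl[of "\<Union>i\<in>I. {ws. set ws \<inter> S i = {}}" ?D] by simp
  then show ?thesis using bad by simp
qed


section \<open>The spanner protocol\<close>

text \<open>The state of a player is the part of the current breadth-first search tree that it has been
  told about, as a map from the visited vertices to their distances from the root.\<close>

datatype query =
    Degree nat | Neighbour nat nat | Spanner_edge nat | Boundary_arc
  | Root nat | Label nat nat

fun label_update :: "(nat \<rightharpoonup> nat) \<Rightarrow> query \<Rightarrow> (nat \<rightharpoonup> nat)" where
  "label_update lab (Root w) = [w \<mapsto> 0]"
| "label_update lab (Label v D) = lab(v \<mapsto> D)"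
| "label_update lab _ = lab"

definition boundary :: "nat set set \<Rightarrow> (nat \<rightharpoonup> nat) \<Rightarrow> (nat \<times> nat) set" where
  "boundary E lab = {(p, v). {p, v} \<in> E \<and> p \<in> dom lab \<and> v \<notin> dom lab}"

definition nearest :: "(nat \<rightharpoonup> nat) \<Rightarrow> (nat \<times> nat) set \<Rightarrow> nat \<times> nat" where
  "nearest lab B = arg_min (\<lambda>a. the (lab (fst a))) (\<lambda>a. a \<in> B)"

text \<open>Each player can compute this from its own edges. Edges become ordered pairs to match the
  format of answers, and are listed so that they can be requested by index.\<close>

definition spanner_arcs :: "nat \<Rightarrow> nat \<Rightarrow> nat set set \<Rightarrow> (nat \<times> nat) list" where
  "spanner_arcs n L E = (SOME as. length as \<le> 2 * n \<and> (\<forall>(u, v)\<in>set as. {u, v} \<in> E) \<and>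
     (\<forall>u v. {u, v} \<in> E \<longrightarrow> joined ((\<lambda>(u, v). {u, v}) ` set as) (2 * L) u v))"

text \<open>The pair \<open>(0, 0)\<close>, which is not an arc, serves as an empty answer.\<close>

fun answer :: "nat \<Rightarrow> nat \<Rightarrow> nat set set \<Rightarrow> (nat \<rightharpoonup> nat) \<Rightarrow> query \<Rightarrow> nat \<times> nat" where
  "answer n L E lab (Degree v) = (card (nbrs E v), 0)"
| "answer n L E lab (Neighbour v l) =
     (if l < card (nbrs E v) then (v, sorted_list_of_set (nbrs E v) ! l) else (0, 0))"
| "answer n L E lab (Spanner_edge l) =
     (if l < length (spanner_arcs n L E) then spanner_arcs n L E ! l else (0, 0))"
| "answer n L E lab Boundary_arc =
     (if boundary E lab = {} then (0, 0) else nearest lab (boundary E lab))"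
| "answer n L E lab _ = (0, 0)"

text \<open>Quadratically many, so that a query fits into \<open>2 * L + 1\<close> bits. Labels
  below \<open>n\<close> suffice because a distance is less than the number of visited
  vertices.\<close>

definition queries :: "nat \<Rightarrow> query set" where
  "queries n = Degree ` {..<n} \<union> (\<lambda>(v, l). Neighbour v l) ` ({..<n} \<times> {..<n}) \<union>
     Spanner_edge ` {..<2 * n} \<union> {Boundary_arc} \<union> Root ` {..<n} \<union>
     (\<lambda>(v, D). Label v D) ` ({..<n} \<times> {..<n})"

definition answers :: "nat \<Rightarrow> (nat \<times> nat) set" where
  "answers n = {..n} \<times> {..n}"

text \<open>Dropping loops discards exactly the empty answers \<open>(0, 0)\<close> among the
  replies collected by the protocol.\<close>

definition edges_of :: "(nat \<times> nat) set \<Rightarrow> nat set set" where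
  "edges_of S = (\<lambda>(u, v). {u, v}) ` {a \<in> S. fst a \<noteq> snd a}"

lemma edges_of_iff: "e \<in> edges_of S \<longleftrightarrow> (\<exists>u v. (u, v) \<in> S \<and> u \<noteq> v \<and> e = {u, v})"
  by (force simp: edges_of_def)

section \<open>Size of the query set and properties of single answers\<close>

lemma finite_queries: "finite (queries n)"
  by (simp add: queries_def)

lemma card_queries: "card (queries n) \<le> 2 * n\<^sup>2 + 4 * n + 1"
proof -
  have "card (queries n) \<le> card (Degree ` {..<n}) + card ((\<lambda>(v, l). Neighbour v l) ` ({..<n} \<times> {..<n})) +
     card (Spanner_edge ` {..<2 * n}) + card {Boundary_arc} + card (Root ` {..<n}) +
     card ((\<lambda>(v, D). Label v D) ` ({..<n} \<times> {..<n}))"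
    unfolding queries_def by (intro order.trans[OF card_Un_le] add_mono order_refl)
  also have "\<dots> \<le> n + n * n + 2 * n + 1 + n + n * n"
    by (intro add_mono order.trans[OF card_image_le]) auto
  finally show ?thesis by (simp add: power2_eq_square)
qed

lemma nearest:
  assumes "B \<noteq> {}"
  shows "nearest lab B \<in> B" "a \<in> B \<Longrightarrow> the (lab (fst (nearest lab B))) \<le> the (lab (fst a))"
proof -
  obtain b where "b \<in> B" using assms by blast
  note * = arg_min_nat_lemma[of "\<lambda>a. a \<in> B", OF this, of "\<lambda>a. the (lab (fst a))"]
  show "nearest lab B \<in> B" "a \<in> B \<Longrightarrow> the (lab (fst (nearest lab B))) \<le> the (lab (fst a))"
    using * unfolding nearest_def by blast+
qed

lemma spanner_arcs:
  assumes E: "E \<subseteq> simple_edges n" and L: "n < 2 ^ L"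
  shows "length (spanner_arcs n L E) \<le> 2 * n"
    and "(u, v) \<in> set (spanner_arcs n L E) \<Longrightarrow> {u, v} \<in> E"
    and "{u, v} \<in> E \<Longrightarrow> joined ((\<lambda>(u, v). {u, v}) ` set (spanner_arcs n L E)) (2 * L) u v"
proof -
  have "\<exists>F\<subseteq>E. finite F \<and> card F \<le> 2 * card {..<n} \<and> (\<forall>u v. {u, v} \<in> E \<longrightarrow> joined F (2 * L) u v)"
  proof (rule low_stretch_subgraph)
    fix e assume "e \<in> E"
    then have "e \<in> simple_edges n" using E by blast
    then show "\<exists>u\<in>{..<n}. \<exists>v\<in>{..<n}. e = {u, v}" unfolding simple_edges_def by blast
  qed (use L in auto)
  then obtain F where F: "F \<subseteq> E" "finite F" "card F \<le> 2 * n"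
    "\<forall>u v. {u, v} \<in> E \<longrightarrow> joined F (2 * L) u v" by auto
  have "\<exists>a. (\<lambda>(u, v). {u, v}) a = e" if e: "e \<in> F" for e
  proof -
    have "e \<in> simple_edges n" using e F(1) E by blast
    then obtain u v where "e = {u, v}" unfolding simple_edges_def by blast
    then show ?thesis by (intro exI[of _ "(u, v)"]) simp
  qed
  then obtain arc where arc: "\<And>e. e \<in> F \<Longrightarrow> (\<lambda>(u, v). {u, v}) (arc e) = e" by metis
  obtain es where es: "set es = F" "distinct es" using finite_distinct_list[OF F(2)] by blast
  have img: "(\<lambda>(u, v). {u, v}) ` set (map arc es) = F"
    using arc es(1) by (force simp: image_image)
  have "length (map arc es) \<le> 2 * n" using F(3) es distinct_card by fastforce
  moreover have "\<forall>(u, v)\<in>set (map arc es). {u, v} \<in> E" using img F(1) by blast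
  ultimately have ex: "\<exists>as. length as \<le> 2 * n \<and> (\<forall>(u, v)\<in>set as. {u, v} \<in> E) \<and>
     (\<forall>u v. {u, v} \<in> E \<longrightarrow> joined ((\<lambda>(u, v). {u, v}) ` set as) (2 * L) u v)"
    using F(4) unfolding img[symmetric] by blast
  note * = someI_ex[OF ex, folded spanner_arcs_def]
  show "length (spanner_arcs n L E) \<le> 2 * n"
    and "(u, v) \<in> set (spanner_arcs n L E) \<Longrightarrow> {u, v} \<in> E"
    and "{u, v} \<in> E \<Longrightarrow> joined ((\<lambda>(u, v). {u, v}) ` set (spanner_arcs n L E)) (2 * L) u v"
    using * by blast+
qed

lemma answer_in_answers:
  assumes E: "E \<subseteq> simple_edges n" and L: "n < 2 ^ L" and q: "q \<in> queries n"
  shows "answer n L E lab q \<in> answers n"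
proof -
  have edge: "(u, v) \<in> answers n" if "{u, v} \<in> E" for u v
    using edge_in_simple_edges[OF E that] by (auto simp: answers_def)
  have empty: "(0, 0) \<in> answers n" by (simp add: answers_def)
  show ?thesis
  proof (cases q)
    case (Degree v)
    have "card (nbrs E v) \<le> card {..<n}" by (rule card_mono) (use nbrs_subset[OF E] in auto)
    then show ?thesis using Degree by (simp add: answers_def)
  next
    case (Neighbour v l)
    have "sorted_list_of_set (nbrs E v) ! l \<in> nbrs E v" if "l < card (nbrs E v)"
      using that finite_nbrs[OF E] nth_mem[of l "sorted_list_of_set (nbrs E v)"] by simp
    then show ?thesis using Neighbour edge empty by (auto simp: nbrs_def)
  next
    case (Spanner_edge l)
    obtain u v where uv: "spanner_arcs n L E ! l = (u, v)" by force
    have "{u, v} \<in> E" if "l < length (spanner_arcs n L E)"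
      using spanner_arcs(2)[OF E L] that uv nth_mem by metis
    then show ?thesis using Spanner_edge edge empty uv by auto
  next
    case Boundary_arc
    obtain u v where uv: "nearest lab (boundary E lab) = (u, v)" by force
    have "{u, v} \<in> E" if "boundary E lab \<noteq> {}"
      using nearest(1)[OF that, of lab] uv by (simp add: boundary_def)
    then show ?thesis using Boundary_arc edge empty uv by auto
  qed (use empty in auto)
qed

text \<open>Serves the search twice: an empty boundary means that every reachable vertex is visited,
  and a walk to an unvisited vertex uses a boundary arc whose tail is reached in fewer
  steps.\<close>

lemma joined_leaves:
  assumes "joined E l w v" "w \<in> S" "v \<notin> S"
  shows "\<exists>y z j. y \<in> S \<and> z \<notin> S \<and> {y, z} \<in> E \<and> joined E j w y \<and> j < l"
  using assms
proof (induction l arbitrary: v)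
  case (Suc l)
  then obtain u where u: "joined E l w u" "{u, v} \<in> E" by (auto simp: joined_Suc)
  show ?case
  proof (cases "u \<in> S")
    case True
    then show ?thesis using u Suc.prems by blast
  next
    case False
    then show ?thesis using Suc.IH[OF u(1)] Suc.prems(2) less_SucI by blast
  qed
qed auto

section \<open>Breadth-first search with distributed edges\<close>

locale spanner_protocol =
  fixes n s L :: nat
  assumes n_ge: "2 \<le> n" and s_ge: "0 < s" and n_less: "n < 2 ^ L"
begin

sublocale word_protocol s "2 * L + 1" "queries n" "answers n" Map.empty label_update "answer n L"
proof
  \<comment> \<open>Twice \<open>(n + 1) ^ 2\<close> exceeds both the number of queries and the
    number of answers; the factor 2 is the extra bit of a word.\<close>
  have "(n + 1)\<^sup>2 \<le> (2 ^ L)\<^sup>2" using n_less by (intro power_mono) auto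
  then have "2 * (n + 1)\<^sup>2 \<le> 2 ^ (2 * L + 1)" by (simp add: power_mult[symmetric] mult.commute)
  then have *: "2 * n\<^sup>2 + 4 * n + 2 \<le> 2 ^ (2 * L + 1)" by (simp add: power2_eq_square)
  then show "card (queries n) \<le> 2 ^ (2 * L + 1)" using card_queries[of n] by linarith
  show "card (answers n) \<le> 2 ^ (2 * L + 1)"
    using * by (simp add: answers_def power2_eq_square)
qed (use s_ge finite_queries in \<open>auto simp: answers_def\<close>)

text \<open>Extending the tree along an arc of least label keeps all labels equal to distances, as in
  Dijkstra's algorithm, so that the players need not agree on the order of a queue.\<close>

primrec bfs :: "nat \<Rightarrow> (nat \<rightharpoonup> nat) \<Rightarrow> nat set set \<Rightarrow>
    (nat set set \<Rightarrow> (query, nat \<times> nat, nat set set) strategy) \<Rightarrow> (query, nat \<times> nat, nat set set) strategy" where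
  "bfs 0 lab H k = k H"
| "bfs (Suc m) lab H k = gather_set ({..<s} \<times> {Boundary_arc}) (\<lambda>g.
     let C = {a. (\<exists>i<s. a = g i Boundary_arc) \<and> fst a \<noteq> snd a} in
     if C = {} then k H
     else let a = nearest lab C; D = Suc (the (lab (fst a))) in
       broadcast [0..<s] (Label (snd a) D) (bfs m (lab(snd a \<mapsto> D)) (insert {fst a, snd a} H) k))"

text \<open>\<open>m\<close> is fuel: each iteration visits a new vertex for \<open>s\<close>
  reports and \<open>s\<close> labels, and none is left once \<open>m\<close> is 0.
  \<open>upper\<close> and \<open>lower\<close> make labels exact distances in \<open>H\<close> and
  \<open>G\<close> alike, and \<open>small\<close> keeps them below \<open>n\<close>, so that
  \<open>Label\<close> stays a legal query.\<close>

lemma achieves_bfs: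
  fixes E :: "nat \<Rightarrow> nat set set"
  defines "G \<equiv> \<Union>i<s. E i"
  assumes E: "\<And>i. i < s \<Longrightarrow> E i \<subseteq> simple_edges n"
    and lab: "lab w = Some 0" "dom lab \<subseteq> {..<n}" "n \<le> m + card (dom lab)"
    and H: "H \<subseteq> G"
    and upper: "\<And>v D. lab v = Some D \<Longrightarrow> joined H D w v"
    and lower: "\<And>v D l. lab v = Some D \<Longrightarrow> joined G l w v \<Longrightarrow> D \<le> l"
    and small: "\<And>v D. lab v = Some D \<Longrightarrow> D < card (dom lab)"
    and st: "\<And>i. i < s \<Longrightarrow> st i = lab"
    and k: "\<And>H' st'. H \<subseteq> H' \<Longrightarrow> H' \<subseteq> G \<Longrightarrow> (\<And>v l. joined G l w v \<Longrightarrow> joined H' l w v) \<Longrightarrow>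
      achieves E post (k H') st' N"
  shows "achieves E post (bfs m lab H k) st (2 * s * m + N)"
proof -
  have G: "G \<subseteq> simple_edges n" using E by (auto simp: G_def)
  have finished: "joined H l w v" if "boundary G lab = {}" "lab w = Some 0"
      "\<And>v D. lab v = Some D \<Longrightarrow> joined H D w v"
      "\<And>v D l. lab v = Some D \<Longrightarrow> joined G l w v \<Longrightarrow> D \<le> l" "joined G l w v"
    for lab H l v
  proof -
    have "v \<in> dom lab"
      using joined_leaves[OF that(5), of "dom lab"] that(1,2) by (auto simp: boundary_def)
    then obtain D where "lab v = Some D" by blast
    then show ?thesis using that joined_mono by blast
  qed
  show ?thesis
    using lab H upper lower small st k
  proof (induction m arbitrary: lab H st)
    case 0
    then have "dom lab = {..<n}"
      by (intro card_subset_eq) (auto dest: card_mono[rotated])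
    then have "boundary G lab = {}"
      using edge_in_simple_edges[OF G] by (auto simp: boundary_def)
    then have "\<And>v l. joined G l w v \<Longrightarrow> joined H l w v" using 0 finished by blast
    then show ?case using 0 by simp
  next
    case (Suc m)
    have bound: "boundary G lab = (\<Union>i<s. boundary (E i) lab)"
      by (auto simp: boundary_def G_def)
    have tot: "2 * s * Suc m + N = s + (s + (2 * s * m + N))" by simp
    have Q: "Boundary_arc \<in> queries n" by (simp add: queries_def)
    have "achieves E post (bfs (Suc m) lab H k) st (card ({..<s} \<times> {Boundary_arc}) + (s + (2 * s * m + N)))"
      unfolding bfs.simps
    proof (rule achieves_gather_set)
      fix g assume g: "\<And>i q. (i, q) \<in> {..<s} \<times> {Boundary_arc} \<Longrightarrow> g i q = answer n L (E i) (st i) q"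
      define C where "C = {a. (\<exists>i<s. a = g i Boundary_arc) \<and> fst a \<noteq> snd a}"
      have g': "g i Boundary_arc = (if boundary (E i) lab = {} then (0, 0) else nearest lab (boundary (E i) lab))"
        if "i < s" for i using g[of i Boundary_arc] Suc.prems(8)[OF that] that by simp
      have C_bound: "C \<subseteq> boundary G lab"
      proof
        fix a assume "a \<in> C"
        then obtain i where i: "i < s" "a = g i Boundary_arc" "fst a \<noteq> snd a" by (auto simp: C_def)
        then have "boundary (E i) lab \<noteq> {}" "a = nearest lab (boundary (E i) lab)"
          using g'[OF i(1)] by (auto split: if_splits)
        then have "a \<in> boundary (E i) lab" using nearest(1) by blast
        then show "a \<in> boundary G lab" unfolding bound using i(1) by blast
      qed
      \<comment> \<open>The holder of \<open>a\<close> has itself reported an arc that starts no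
        farther from the root, so the minimum of the local minima is a minimum over
        \<open>boundary G lab\<close>.\<close>
      have C_min: "\<exists>b\<in>C. the (lab (fst b)) \<le> the (lab (fst a))" if a: "a \<in> boundary G lab" for a
      proof -
        obtain i where i: "i < s" "a \<in> boundary (E i) lab" using a bound by auto
        then have ne: "boundary (E i) lab \<noteq> {}" by blast
        have "nearest lab (boundary (E i) lab) \<in> boundary (E i) lab" using nearest(1)[OF ne] .
        then have "fst (nearest lab (boundary (E i) lab)) \<noteq> snd (nearest lab (boundary (E i) lab))"
          by (auto simp: boundary_def)
        then have "nearest lab (boundary (E i) lab) \<in> C"
          using g'[OF i(1)] ne i(1) unfolding C_def by auto
        then show ?thesis using nearest(2)[OF ne i(2)] by blast
      qed
      show "achieves E post (let C = {a. (\<exists>i<s. a = g i Boundary_arc) \<and> fst a \<noteq> snd a} in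
          if C = {} then k H
          else let a = nearest lab C; D = Suc (the (lab (fst a))) in
            broadcast [0..<s] (Label (snd a) D) (bfs m (lab(snd a \<mapsto> D)) (insert {fst a, snd a} H) k))
         st (s + (2 * s * m + N))"
      proof (cases "C = {}")
        case True
        then have "boundary G lab = {}" using C_min by blast
        then have "\<And>v l. joined G l w v \<Longrightarrow> joined H l w v" using Suc.prems finished by blast
        then have "achieves E post (k H) st N" using Suc.prems by blast
        then have "achieves E post (k H) st (s + (2 * s * m + N))" by (rule achieves_mono) simp
        then show ?thesis using True by (simp add: C_def Let_def)
      next
        case False
        obtain p v where pv: "nearest lab C = (p, v)" by force
        define D where "D = Suc (the (lab p))"
        have pvC: "(p, v) \<in> boundary G lab" using nearest(1)[OF False, of lab] pv C_bound by auto
        have pv_min: "the (lab p) \<le> the (lab (fst a))" if "a \<in> boundary G lab" for a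
          using C_min[OF that] nearest(2)[OF False, of _ lab] pv by (metis fst_conv le_trans)
        have edge: "{p, v} \<in> G" "p \<in> dom lab" "v \<notin> dom lab"
          using pvC by (auto simp: boundary_def)
        have vn: "v < n" using edge_in_simple_edges[OF G edge(1)] by simp
        obtain Dp where Dp: "lab p = Some Dp" using edge(2) by blast
        \<comment> \<open>Dijkstra's argument: a walk to \<open>v\<close> leaves the visited
          vertices along some boundary arc, whose tail is at least as far from \<open>w\<close> as
          \<open>p\<close>.\<close>
        have lower_v: "D \<le> l" if vl: "joined G l w v" for l
        proof -
          obtain y z j where yz: "y \<in> dom lab" "z \<notin> dom lab" "{y, z} \<in> G" "joined G j w y" "j < l"
            using joined_leaves[OF vl, of "dom lab"] edge(3) Suc.prems(1) by blast
          then have "the (lab p) \<le> the (lab y)" using pv_min[of "(y, z)"] by (simp add: boundary_def)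
          also have "\<dots> \<le> j" using yz(1,4) Suc.prems(6) by auto
          finally show ?thesis using yz(5) by (simp add: D_def)
        qed
        have fin: "finite (dom lab)" using Suc.prems(2) finite_subset by blast
        have card_Suc: "card (dom (lab(v \<mapsto> D))) = Suc (card (dom lab))"
          using edge(3) fin by simp
        have D_le: "D \<le> card (dom lab)" using Suc.prems(7)[OF Dp] Dp by (simp add: D_def)
        have "card (insert v (dom lab)) \<le> card {..<n}"
          using Suc.prems(2) vn by (intro card_mono) auto
        then have Dn: "D < n" using D_le edge(3) fin by simp
        have "achieves E post (broadcast [0..<s] (Label v D) (bfs m (lab(v \<mapsto> D)) (insert {p, v} H) k))
           st (length [0..<s] + (2 * s * m + N))"
        proof (rule achieves_broadcast)
          show "Label v D \<in> queries n" using vn Dn by (auto simp: queries_def)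
          show "achieves E post (bfs m (lab(v \<mapsto> D)) (insert {p, v} H) k)
            (\<lambda>i. if i \<in> set [0..<s] then label_update (st i) (Label v D) else st i) (2 * s * m + N)"
          proof (rule Suc.IH)
            show "(lab(v \<mapsto> D)) w = Some 0" using Suc.prems(1) edge(3) by auto
            show "dom (lab(v \<mapsto> D)) \<subseteq> {..<n}" using Suc.prems(2) vn by auto
            show "n \<le> m + card (dom (lab(v \<mapsto> D)))" using Suc.prems(3) card_Suc by simp
            show "D' < card (dom (lab(v \<mapsto> D)))" if "(lab(v \<mapsto> D)) v' = Some D'" for v' D'
              using that D_le Suc.prems(7)[of v' D'] unfolding card_Suc by (auto split: if_splits)
            show "insert {p, v} H \<subseteq> G" using Suc.prems(4) edge(1) by simp
            show "joined (insert {p, v} H) D' w v'" if "(lab(v \<mapsto> D)) v' = Some D'" for v' D'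
            proof (cases "v' = v")
              case True
              have "joined (insert {p, v} H) Dp w p"
                using Suc.prems(5)[OF Dp] by (rule joined_mono) auto
              then have "joined (insert {p, v} H) (Suc Dp) w v" by (auto simp: joined_Suc)
              then show ?thesis using True that Dp by (simp add: D_def)
            next
              case False
              then have "joined H D' w v'" using that Suc.prems(5) by simp
              then show ?thesis by (rule joined_mono) auto
            qed
            show "D' \<le> l" if "(lab(v \<mapsto> D)) v' = Some D'" "joined G l w v'" for v' D' l
              using that lower_v Suc.prems(6) by (auto split: if_splits)
            show "achieves E post (k H') st' N"
              if "insert {p, v} H \<subseteq> H'" "H' \<subseteq> G" "\<And>v l. joined G l w v \<Longrightarrow> joined H' l w v"
              for H' st' using that Suc.prems(9) by auto
          qed (use Suc.prems(8) in auto)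
        qed (auto simp: answers_def)
        then show ?thesis
          using False unfolding Let_def C_def[symmetric] by (simp add: pv D_def)
      qed
    qed (use Suc.prems(8) Q answer_in_answers[OF E n_less Q] in auto)
    then show ?case unfolding tot by simp
  qed
qed

primrec bfs_all :: "nat list \<Rightarrow> nat set set \<Rightarrow> (query, nat \<times> nat, nat set set) strategy" where
  "bfs_all [] H = Return H"
| "bfs_all (w # ws) H = broadcast [0..<s] (Root w) (bfs n [w \<mapsto> 0] H (bfs_all ws))"

text \<open>\<open>st\<close> is arbitrary since \<open>Root\<close> overwrites whatever the
  previous search left behind. Later searches only add edges, so the distances secured by earlier
  trees persist.\<close>

lemma achieves_bfs_all:
  fixes E :: "nat \<Rightarrow> nat set set"
  defines "G \<equiv> \<Union>i<s. E i"
  assumes E: "\<And>i. i < s \<Longrightarrow> E i \<subseteq> simple_edges n"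
    and ws: "set ws \<subseteq> {..<n}" and H: "H \<subseteq> G"
    and post: "\<And>H'. H \<subseteq> H' \<Longrightarrow> H' \<subseteq> G \<Longrightarrow>
      (\<And>w v l. w \<in> set ws \<Longrightarrow> joined G l w v \<Longrightarrow> joined H' l w v) \<Longrightarrow> post H'"
  shows "achieves E post (bfs_all ws H) st (length ws * (s + 2 * s * n))"
  using ws H post
proof (induction ws arbitrary: H st)
  case Nil
  then show ?case by simp
next
  case (Cons w ws)
  let ?N = "length ws * (s + 2 * s * n)"
  have "achieves E post (bfs_all (w # ws) H) st (length [0..<s] + (2 * s * n + ?N))"
    unfolding bfs_all.simps
  proof (rule achieves_broadcast)
    show "Root w \<in> queries n" using Cons.prems(1) by (auto simp: queries_def)
    show "achieves E post (bfs n [w \<mapsto> 0] H (bfs_all ws))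
      (\<lambda>i. if i \<in> set [0..<s] then label_update (st i) (Root w) else st i) (2 * s * n + ?N)"
    proof (rule achieves_bfs[where w = w])
      fix H' st'
      assume H': "H \<subseteq> H'" "H' \<subseteq> (\<Union>i<s. E i)"
        "\<And>v l. joined (\<Union>i<s. E i) l w v \<Longrightarrow> joined H' l w v"
      show "achieves E post (bfs_all ws H') st' ?N"
      proof (rule Cons.IH)
        show "set ws \<subseteq> {..<n}" "H' \<subseteq> G" using Cons.prems(1) H' by (auto simp: G_def)
        fix H'' assume H'': "H' \<subseteq> H''" "H'' \<subseteq> G"
          "\<And>w v l. w \<in> set ws \<Longrightarrow> joined G l w v \<Longrightarrow> joined H'' l w v"
        show "post H''"
        proof (rule Cons.prems(3))
          show "joined H'' l w' v" if "w' \<in> set (w # ws)" "joined G l w' v" for w' v l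
          proof (cases "w' = w")
            case True
            then have "joined H' l w' v" using H'(3) that by (simp add: G_def)
            then show ?thesis using H''(1) by (rule joined_mono) simp
          next
            case False
            then show ?thesis using that H''(3) by simp
          qed
        qed (use H' H'' in auto)
      qed
    qed (use E Cons.prems in \<open>auto simp: G_def split: if_splits\<close>)
  qed (auto simp: answers_def)
  then show ?case by (simp add: algebra_simps)
qed

text \<open>The reported degrees tell how many neighbours each player can name, so only existing
  ones are requested. The size of \<open>S\<close> is then the sum of the light degrees, without a
  factor \<open>s\<close>.\<close>

definition spanner_strategy :: "nat \<Rightarrow> nat list \<Rightarrow> (query, nat \<times> nat, nat set set) strategy" where
  "spanner_strategy d ws = gather_set ({..<s} \<times> Degree ` {..<n}) (\<lambda>g.
     let light = {v. v < n \<and> (\<Sum>i<s. fst (g i (Degree v))) < d};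
       S = {(i, Neighbour v l) | i v l. v \<in> light \<and> i < s \<and> l < fst (g i (Degree v))};
       T = {..<s} \<times> Spanner_edge ` {..<2 * n}
     in gather_set S (\<lambda>h. gather_set T (\<lambda>f.
       bfs_all ws (edges_of (case_prod h ` S \<union> case_prod f ` T)))))"

lemma achieves_spanner_strategy:
  assumes E: "E \<in> disjoint_edge_inputs s n" and ws: "set ws \<subseteq> {..<n}"
    and d: "0 < d" and k: "2 \<le> k"
  shows "achieves E (\<lambda>H. (\<forall>u<n. \<forall>v<n. k * d < 6 * L * card (geodesic_nbhd (\<Union>i<s. E i) u v) \<longrightarrow>
        set ws \<inter> geodesic_nbhd (\<Union>i<s. E i) u v \<noteq> {}) \<longrightarrow> additive_spanner n k (\<Union>i<s. E i) H)
     (spanner_strategy d ws) st (s * n + (n * d + (s * (2 * n) + length ws * (s + 2 * s * n))))"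
proof -
  define G where "G = (\<Union>i<s. E i)"
  define post where "post H \<longleftrightarrow> (\<forall>u<n. \<forall>v<n. k * d < 6 * L * card (geodesic_nbhd G u v) \<longrightarrow>
        set ws \<inter> geodesic_nbhd G u v \<noteq> {}) \<longrightarrow> additive_spanner n k G H" for H
  define T where "T = {..<s} \<times> Spanner_edge ` {..<2 * n}"
  have Ei: "E i \<subseteq> simple_edges n" if "i < s" for i
    using E that by (auto simp: disjoint_edge_inputs_def)
  have disj: "disjoint_family_on E {..<s}" using E by (simp add: disjoint_edge_inputs_def)
  have G: "G \<subseteq> simple_edges n" using Ei by (auto simp: G_def)
  have ans: "answer n L (E i) (st i) q \<in> answers n" if "i < s" "q \<in> queries n" for i q
    using answer_in_answers[OF Ei n_less] that by blast
  \<comment> \<open>Here disjointness enters: with duplicated edges the sum could exceed the degree,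
    and light vertices could not be recognised from it.\<close>
  have deg: "card (nbrs G v) = (\<Sum>i<s. card (nbrs (E i) v))" for v
  proof -
    have "nbrs G v = (\<Union>i<s. nbrs (E i) v)" by (auto simp: nbrs_def G_def)
    moreover have "nbrs (E i) v \<inter> nbrs (E j) v = {}" if "i < s" "j < s" "i \<noteq> j" for i j
      using disjoint_family_onD[OF disj, of i j] that by (auto simp: nbrs_def)
    ultimately show ?thesis using finite_nbrs[OF Ei] by (simp add: card_UN_disjoint)
  qed
  have card_Deg: "card ({..<s} \<times> Degree ` {..<n}) = s * n"
    by (simp add: card_cartesian_product card_image inj_on_def)
  have card_T: "card T = s * (2 * n)"
    by (simp add: T_def card_cartesian_product card_image inj_on_def)
  have "achieves E post (spanner_strategy d ws) st
     (card ({..<s} \<times> Degree ` {..<n}) + (n * d + (s * (2 * n) + length ws * (s + 2 * s * n))))"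
    unfolding spanner_strategy_def T_def[symmetric]
  proof (rule achieves_gather_set)
    fix g assume g: "\<And>i q. (i, q) \<in> {..<s} \<times> Degree ` {..<n} \<Longrightarrow> g i q = answer n L (E i) (st i) q"
    define light where "light = {v. v < n \<and> (\<Sum>i<s. fst (g i (Degree v))) < d}"
    define S where "S = {(i, Neighbour v l) | i v l. v \<in> light \<and> i < s \<and> l < fst (g i (Degree v))}"
    have g': "fst (g i (Degree v)) = card (nbrs (E i) v)" if "i < s" "v < n" for i v
      using g[of i "Degree v"] that by simp
    have light: "v \<in> light \<longleftrightarrow> v < n \<and> card (nbrs G v) < d" for v
      unfolding light_def deg using g' by auto
    have S: "(i, q) \<in> S \<longleftrightarrow> (\<exists>v l. q = Neighbour v l \<and> v \<in> light \<and> i < s \<and> l < card (nbrs (E i) v))" for i q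
      unfolding S_def using g' light by auto
    have S_sub: "S \<subseteq> (\<lambda>(v, i, l). (i, Neighbour v l)) `
        (SIGMA v:light. SIGMA i:{..<s}. {..<card (nbrs (E i) v)})"
      using S by (force simp: image_iff)
    have fin_light: "finite light" by (simp add: light_def)
    then have finS: "finite S" using S_sub by (rule_tac finite_subset) auto
    have "card S \<le> card (SIGMA v:light. SIGMA i:{..<s}. {..<card (nbrs (E i) v)})"
      using S_sub fin_light by (intro surj_card_le) auto
    also have "\<dots> = (\<Sum>v\<in>light. card (nbrs G v))"
      using fin_light by (simp add: deg)
    also have "\<dots> \<le> card light * d"
      using sum_bounded_above[of light "\<lambda>v. card (nbrs G v)" d] light by (simp add: less_imp_le)
    also have "card light \<le> n" using card_mono[of "{..<n}" light] by (auto simp: light_def)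
    finally have card_S: "card S \<le> n * d" by simp
    have nb_lt: "card (nbrs (E i) v) \<le> n" if "i < s" for i v
      using card_mono[of "{..<n}" "nbrs (E i) v"] nbrs_subset[OF Ei[OF that]] by simp
    have SQ: "q \<in> queries n" if iq: "(i, q) \<in> S" for i q
    proof -
      obtain v l where "q = Neighbour v l" "v < n" "i < s" "l < card (nbrs (E i) v)"
        using iq S light by blast
      then show ?thesis using nb_lt[of i v] by (auto simp: queries_def intro!: image_eqI[of _ _ "(v, l)"])
    qed
    have "achieves E post (gather_set S (\<lambda>h. gather_set T (\<lambda>f.
       bfs_all ws (edges_of (case_prod h ` S \<union> case_prod f ` T)))))
        st (card S + (card T + length ws * (s + 2 * s * n)))"
    proof (rule achieves_gather_set[OF finS])
      fix h assume h: "\<And>i q. (i, q) \<in> S \<Longrightarrow> h i q = answer n L (E i) (st i) q"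
      show "achieves E post (gather_set T (\<lambda>f.
         bfs_all ws (edges_of (case_prod h ` S \<union> case_prod f ` T)))) st (card T + length ws * (s + 2 * s * n))"
      proof (rule achieves_gather_set)
        fix f assume f: "\<And>i q. (i, q) \<in> T \<Longrightarrow> f i q = answer n L (E i) (st i) q"
        define H where "H = edges_of (case_prod h ` S \<union> case_prod f ` T)"
        have arc: "{a, b} \<in> H" if "(i, q) \<in> S \<and> h i q = (a, b) \<or> (i, q) \<in> T \<and> f i q = (a, b)" "a \<noteq> b" for i q a b
          using that unfolding H_def edges_of_iff by force
        have HG: "H \<subseteq> G"
        proof
          fix e assume "e \<in> H"
          then obtain a b where ab: "e = {a, b}" "a \<noteq> b" "(a, b) \<in> case_prod h ` S \<union> case_prod f ` T"
            unfolding H_def edges_of_iff by blast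
          from ab(3) show "e \<in> G"
          proof
            assume "(a, b) \<in> case_prod h ` S"
            then obtain i q where iq: "(i, q) \<in> S" "h i q = (a, b)" by auto
            then obtain v l where vl: "q = Neighbour v l" "i < s" "l < card (nbrs (E i) v)" using S by blast
            then have "a = v" "b = sorted_list_of_set (nbrs (E i) v) ! l"
              using h[OF iq(1)] iq(2) by auto
            moreover have "sorted_list_of_set (nbrs (E i) v) ! l \<in> nbrs (E i) v"
              using vl finite_nbrs[OF Ei] nth_mem[of l "sorted_list_of_set (nbrs (E i) v)"] by simp
            ultimately show ?thesis using vl ab(1) by (auto simp: nbrs_def G_def)
          next
            assume "(a, b) \<in> case_prod f ` T"
            then obtain i q where iq: "(i, q) \<in> T" "f i q = (a, b)" by auto
            then obtain l where l: "q = Spanner_edge l" "i < s" by (auto simp: T_def)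
            then have "l < length (spanner_arcs n L (E i))" "spanner_arcs n L (E i) ! l = (a, b)"
              using f[OF iq(1)] iq(2) ab(2) by (auto split: if_splits)
            then have "(a, b) \<in> set (spanner_arcs n L (E i))" by (metis nth_mem)
            then show ?thesis
              using spanner_arcs(2)[OF Ei n_less] l(2) ab(1) by (auto simp: G_def)
          qed
        qed
        have light_H: "{u, v} \<in> H" if uv: "{u, v} \<in> G" "card (nbrs G u) < d" for u v
        proof -
          obtain i where i: "i < s" "{u, v} \<in> E i" using uv(1) by (auto simp: G_def)
          have uvn: "u < n" "u \<noteq> v" using edge_in_simple_edges[OF G uv(1)] by auto
          have "v \<in> set (sorted_list_of_set (nbrs (E i) u))"
            using i finite_nbrs[OF Ei[OF i(1)]] by (simp add: nbrs_def)
          then obtain l where l: "l < card (nbrs (E i) u)" "sorted_list_of_set (nbrs (E i) u) ! l = v"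
            by (auto simp: in_set_conv_nth)
          have "(i, Neighbour u l) \<in> S" using S light uvn(1) uv(2) i(1) l(1) by blast
          then show ?thesis using arc[of i "Neighbour u l" u v] h l uvn(2) by simp
        qed
        have stretch: "joined H (2 * L) u v" if uv: "{u, v} \<in> G" for u v
        proof -
          obtain i where i: "i < s" "{u, v} \<in> E i" using uv by (auto simp: G_def)
          note sp = spanner_arcs[OF Ei[OF i(1)] n_less]
          have "(\<lambda>(u, v). {u, v}) ` set (spanner_arcs n L (E i)) \<subseteq> H"
          proof
            fix e assume "e \<in> (\<lambda>(u, v). {u, v}) ` set (spanner_arcs n L (E i))"
            then obtain a b where ab: "e = {a, b}" "(a, b) \<in> set (spanner_arcs n L (E i))" by auto
            then obtain l where l: "l < length (spanner_arcs n L (E i))" "spanner_arcs n L (E i) ! l = (a, b)"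
              by (auto simp: in_set_conv_nth)
            have "a \<noteq> b" using sp(2)[OF ab(2)] edge_in_simple_edges[OF Ei[OF i(1)]] by blast
            moreover have "(i, Spanner_edge l) \<in> T" using i(1) l(1) sp(1) by (auto simp: T_def)
            ultimately show "e \<in> H" using arc[of i "Spanner_edge l" a b] f l ab(1) by simp
          qed
          then show ?thesis by (rule joined_mono[OF sp(3)[OF i(2)]]) simp
        qed
        show "achieves E post (bfs_all ws H) st (length ws * (s + 2 * s * n))"
        proof (rule achieves_bfs_all)
          fix H' assume H': "H \<subseteq> H'" "H' \<subseteq> (\<Union>i<s. E i)"
            "\<And>w v l. w \<in> set ws \<Longrightarrow> joined (\<Union>i<s. E i) l w v \<Longrightarrow> joined H' l w v"
          show "post H'" unfolding post_def
          proof
            assume hit: "\<forall>u<n. \<forall>v<n. k * d < 6 * L * card (geodesic_nbhd G u v) \<longrightarrow>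
              set ws \<inter> geodesic_nbhd G u v \<noteq> {}"
            show "additive_spanner n k G H'"
            proof (rule additive_spanner_if_hitting[where d = d and L = L and C = "set ws"])
              show "joined H' (2 * L) u v" if "{u, v} \<in> G" for u v
                using stretch[OF that] H'(1) by (rule joined_mono) simp
              show "{u, v} \<in> H'" if "{u, v} \<in> G" "card (nbrs G u) < d" for u v
                using light_H[OF that] H'(1) by blast
              show "joined H' l w v" if "w \<in> set ws" "joined G l w v" for w v l
                using H'(3) that unfolding G_def by blast
            qed (use G H'(2) hit d k in \<open>auto simp: G_def[symmetric]\<close>)
          qed
        qed (use Ei ws HG in \<open>auto simp: G_def\<close>)
      next
        fix i q assume "(i, q) \<in> T"
        then obtain l where l: "q = Spanner_edge l" "l < 2 * n" "i < s" by (auto simp: T_def)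
        then have "q \<in> queries n" by (simp add: queries_def)
        then show "i < s \<and> q \<in> queries n \<and> answer n L (E i) (st i) q \<in> answers n \<and> label_update (st i) q = st i"
          using l ans by (simp del: answer.simps)
      qed (simp add: T_def)
    next
      fix i q assume iq: "(i, q) \<in> S"
      then obtain v l where "q = Neighbour v l" "i < s" using S by blast
      then show "i < s \<and> q \<in> queries n \<and> answer n L (E i) (st i) q \<in> answers n \<and> label_update (st i) q = st i"
        using SQ[OF iq] ans by (auto simp del: answer.simps)
    qed
    then have "achieves E post (gather_set S (\<lambda>h. gather_set T (\<lambda>f.
       bfs_all ws (edges_of (case_prod h ` S \<union> case_prod f ` T)))))
        st (n * d + (s * (2 * n) + length ws * (s + 2 * s * n)))"
      by (rule achieves_mono) (use card_S card_T in simp)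
    then show "achieves E post (let light = {v. v < n \<and> (\<Sum>i<s. fst (g i (Degree v))) < d};
           S = {(i, Neighbour v l) | i v l. v \<in> light \<and> i < s \<and> l < fst (g i (Degree v))};
           T = T
         in gather_set S (\<lambda>h. gather_set T (\<lambda>f.
           bfs_all ws (edges_of (case_prod h ` S \<union> case_prod f ` T)))))
       st (n * d + (s * (2 * n) + length ws * (s + 2 * s * n)))"
      unfolding Let_def S_def light_def .
  next
    fix i q assume "(i, q) \<in> {..<s} \<times> Degree ` {..<n}"
    then obtain v where v: "q = Degree v" "v < n" "i < s" by auto
    then have "q \<in> queries n" by (simp add: queries_def)
    then show "i < s \<and> q \<in> queries n \<and> answer n L (E i) (st i) q \<in> answers n \<and> label_update (st i) q = st i"
      using v ans by (simp del: answer.simps)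
  qed simp
  then show ?thesis unfolding card_Deg post_def G_def .
qed

end


section \<open>Choice of parameters\<close>

text \<open>The condition on \<open>R\<close> is the union bound: at most \<open>n ^ 2\<close>
  pairs, each with a neighbourhood of more than \<open>k * d / (6 * L)\<close> vertices to be hit,
  against failure probability 1/3.\<close>

theorem additive_spanner_cc_le:
  fixes n s k d L R :: nat
  assumes n: "2 \<le> n" and s: "0 < s" and k: "2 \<le> k" and d: "0 < d" and L: "n < 2 ^ L"
    and R: "3 * (real n)\<^sup>2 * exp (- (real (k * d) / real (6 * L) * real R / real n)) \<le> 1"
  shows "additive_spanner_cc s n k \<le>
    enat (2 * (2 * L + 1) * (s * n + (n * d + (s * (2 * n) + R * (s + 2 * s * n)))))"
proof -
  interpret spanner_protocol n s L by unfold_locales (use n s L in auto)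
  let ?X = "disjoint_edge_inputs s n"
  let ?V = "{ws. set ws \<subseteq> {..<n} \<and> length ws = R}"
  define good where "good E ws \<longleftrightarrow> (\<forall>u<n. \<forall>v<n. k * d < 6 * L * card (geodesic_nbhd (\<Union>i<s. E i) u v) \<longrightarrow>
        set ws \<inter> geodesic_nbhd (\<Union>i<s. E i) u v \<noteq> {})" for E :: "nat \<Rightarrow> nat set set" and ws
  have L_pos: "0 < L" using L n by (cases L) auto
  have fin: "finite ?V" by (rule finite_lists_length_eq) simp
  have ne: "?V \<noteq> {}"
  proof -
    have "replicate R 0 \<in> ?V" using n by auto
    then show ?thesis by blast
  qed
  show ?thesis
    unfolding additive_spanner_cc_def
  proof (rule randomized_cc_le[where D = "pmf_of_set ?V" and good = good and p = "spanner_strategy d"])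
    fix E ws assume E: "E \<in> ?X" and "ws \<in> set_pmf (pmf_of_set ?V)"
    then have ws: "set ws \<subseteq> {..<n}" "length ws = R" using fin ne by auto
    show "achieves E (\<lambda>y. good E ws \<longrightarrow> additive_spanner n k (\<Union>i<s. E i) y) (spanner_strategy d ws)
        (\<lambda>_. Map.empty) (s * n + (n * d + (s * (2 * n) + R * (s + 2 * s * n))))"
      using achieves_spanner_strategy[OF E ws(1) d k] unfolding ws(2) good_def .
  next
    fix E assume "E \<in> ?X"
    then have G: "(\<Union>i<s. E i) \<subseteq> simple_edges n" by (auto simp: disjoint_edge_inputs_def)
    define \<mu> where "\<mu> = real (k * d) / real (6 * L)"
    define I where "I = {(u, v). u < n \<and> v < n \<and> k * d < 6 * L * card (geodesic_nbhd (\<Union>i<s. E i) u v)}"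
    define S where "S = (\<lambda>(u, v). geodesic_nbhd (\<Union>i<s. E i) u v)"
    have I_sub: "I \<subseteq> {..<n} \<times> {..<n}" by (auto simp: I_def)
    then have finI: "finite I" by (rule finite_subset) auto
    have "card I \<le> n * n" using card_mono[OF _ I_sub] by simp
    then have cardI: "real (card I) \<le> (real n)\<^sup>2"
      by (metis of_nat_le_iff of_nat_mult power2_eq_square)
    have "1 - 1 / 3 \<le> measure_pmf.prob (pmf_of_set ?V) {ws. \<forall>i\<in>I. set ws \<inter> S i \<noteq> {}}"
    proof (rule hitting_set_probability)
      show "\<mu> \<le> real (card (S i))" if i: "i \<in> I" for i
      proof -
        have "k * d < 6 * L * card (S i)" using i by (auto simp: I_def S_def)
        then have "real (k * d) \<le> real (6 * L) * real (card (S i))"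
          unfolding of_nat_mult[symmetric] of_nat_le_iff by simp
        then show ?thesis using L_pos by (simp add: \<mu>_def divide_le_eq mult.commute)
      qed
      have "real (card I) * exp (- (\<mu> * real R / real n)) \<le> (real n)\<^sup>2 * exp (- (\<mu> * real R / real n))"
        using cardI by (rule mult_right_mono) simp
      then show "real (card I) * exp (- (\<mu> * real R / real (card {..<n}))) \<le> 1 / 3"
        using R[folded \<mu>_def] unfolding card_lessThan by linarith
      show "{..<n} \<noteq> {}" using n by (simp add: lessThan_empty_iff)
      show "S i \<subseteq> {..<n}" for i using geodesic_nbhd_subset[OF G] by (simp add: S_def split: prod.split)
    qed (use finI in simp_all)
    also have "{ws. \<forall>i\<in>I. set ws \<inter> S i \<noteq> {}} = {ws. good E ws}"
      by (auto simp: I_def S_def good_def)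
    finally show "2 / 3 \<le> measure_pmf.prob (pmf_of_set ?V) {ws. good E ws}" by simp
  qed
qed

text \<open>The logarithm of the factor in the condition on \<open>R\<close>; it explains the 4 in
  the choice of \<open>R\<close> below.\<close>

lemma ln_three_squares_le:
  assumes "2 \<le> n"
  shows "ln (3 * (real n)\<^sup>2) \<le> 4 * log 2 (real n)"
proof -
  have "1 \<le> log 2 (real n)" using assms by simp
  have "ln (3 * (real n)\<^sup>2) = ln 3 + 2 * ln (real n)"
    using assms by (simp add: ln_mult ln_realpow)
  moreover have "ln (3::real) \<le> 2" using ln_le_minus_one[of "3::real"] by simp
  moreover have "ln (real n) \<le> log 2 (real n)"
  proof -
    have "ln (real n) = log 2 (real n) * ln 2" by (simp add: log_def)
    also have "\<dots> \<le> log 2 (real n) * 1"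
      using \<open>1 \<le> log 2 (real n)\<close> ln_le_minus_one[of "2::real"] by (intro mult_left_mono) auto
    finally show ?thesis by simp
  qed
  ultimately show ?thesis using \<open>1 \<le> log 2 (real n)\<close> by linarith
qed

theorem theorem3p10:
  "\<exists>(C::real) (a::nat). C > 0 \<and>
     (\<forall>n s k :: nat. 2 \<le> n \<and> 1 \<le> s \<and> s \<le> n \<and> 2 \<le> k \<longrightarrow>
        ereal_of_enat (additive_spanner_cc s n k)
          \<le> ereal (C * log 2 (real n) ^ a *
               (sqrt (real s / real k) * real n powr (3 / 2) + real s * real n * real k)))"
proof (intro exI[of _ "3038 :: real"] exI[of _ 3] conjI allI impI)
  \<comment> \<open>3038 = 14 * 217. A round has \<open>4 * L + 2\<close> bits, at most
    \<open>14 * lg\<close>, and there are at most \<open>217 * lg ^ 2 * (S + Y * k)\<close> rounds.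
    Of the 217, the trees cause 216 = 3 * 4 * 6 * 3: rounds per tree in units of
    \<open>s * n\<close>, the union bound, \<open>card_path_nbhd\<close>, and
    \<open>L \<le> 3 * lg\<close>.\<close>
  fix n s k :: nat
  assume "2 \<le> n \<and> 1 \<le> s \<and> s \<le> n \<and> 2 \<le> k"
  then have n: "2 \<le> n" and s: "0 < s" and k: "2 \<le> k" by auto
  define lg where "lg = log 2 (real n)"
  have lg: "1 \<le> lg" using n by (simp add: lg_def)
  \<comment> \<open>The \<open>+ 1\<close> makes \<open>lg < L\<close> strict even if
    \<open>n\<close> is a power of 2; \<open>1 \<le> lg\<close> still gives
    \<open>L \<le> lg + 2 \<le> 3 * lg\<close>.\<close>
  define L where "L = nat \<lceil>lg\<rceil> + 1"
  have L_gt: "lg < real L" and L_le: "real L \<le> 3 * lg"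
    using lg by (simp_all add: L_def) linarith+
  have "real n = 2 powr lg" using n by (simp add: lg_def)
  also have "\<dots> < 2 powr real L" using L_gt by simp
  finally have "real n < real (2 ^ L)" by (simp add: powr_realpow)
  then have n_lt: "n < 2 ^ L" by (simp only: of_nat_less_iff)
  define q where "q = sqrt (real s * real n / real k)"
  have q: "0 < q" using n s k by (simp add: q_def)
  have qq: "q * q = real s * real n / real k" by (simp add: q_def)
  \<comment> \<open>Rounding up adds at most \<open>n\<close> to \<open>n * q\<close>, which
    \<open>Y\<close> absorbs.\<close>
  define d where "d = nat \<lceil>q\<rceil>"
  have d: "0 < d" "q \<le> real d" "real d \<le> q + 1"
    using q unfolding d_def by linarith+
  define \<mu> where "\<mu> = real (k * d) / real (6 * L)"
  have \<mu>: "0 < \<mu>" using d k by (simp add: \<mu>_def L_def)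
  define R where "R = nat \<lceil>4 * lg * real n / \<mu>\<rceil>"
  have R: "4 * lg * real n / \<mu> \<le> real R" "real R \<le> 4 * lg * real n / \<mu> + 1"
  proof -
    have "0 \<le> 4 * lg * real n / \<mu>" using lg \<mu> by simp
    then show "4 * lg * real n / \<mu> \<le> real R" "real R \<le> 4 * lg * real n / \<mu> + 1"
      unfolding R_def by linarith+
  qed
  have "ln (3 * (real n)\<^sup>2) \<le> \<mu> * real R / real n"
  proof -
    have "4 * lg \<le> \<mu> * real R / real n" using R(1) \<mu> n by (simp add: field_simps)
    then show ?thesis using ln_three_squares_le[OF n] by (simp add: lg_def)
  qed
  then have "exp (ln (3 * (real n)\<^sup>2)) * exp (- (\<mu> * real R / real n)) \<le> 1"
    by (simp add: exp_add[symmetric])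
  then have cond: "3 * (real n)\<^sup>2 * exp (- (\<mu> * real R / real n)) \<le> 1"
    using n by simp
  define T where "T = s * n + (n * d + (s * (2 * n) + R * (s + 2 * s * n)))"
  have cc: "additive_spanner_cc s n k \<le> enat (2 * (2 * L + 1) * T)"
    unfolding T_def by (rule additive_spanner_cc_le[OF n s k d(1) n_lt cond[unfolded \<mu>_def]])
  define S where "S = sqrt (real s / real k) * real n powr (3 / 2)"
  have nq: "real n * q = S"
  proof -
    have "real n powr (3 / 2) = real n powr (1 + 1 / 2)" by simp
    also have "\<dots> = real n * sqrt (real n)" using n by (simp only: powr_add powr_half_sqrt) simp
    finally show ?thesis by (simp add: S_def q_def real_sqrt_mult real_sqrt_divide)
  qed
  have S_pos: "0 \<le> S" using q nq by (metis mult_nonneg_nonneg of_nat_0_le_iff less_imp_le)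
  define Y where "Y = real s * real n"
  have Y: "0 \<le> Y" "real n \<le> Y" using mult_right_mono[of 1 "real s" "real n"] s by (simp_all add: Y_def)
  \<comment> \<open>The balance of costs: \<open>Y / k = q * q\<close>, and dividing by
    \<open>d \<ge> q\<close> leaves one factor \<open>q\<close>, with \<open>n * q = S\<close>. One
    \<open>lg\<close> stems from the union bound, the other from \<open>L\<close> in
    \<open>\<mu>\<close>.\<close>
  have "Y * (4 * lg * real n / \<mu>) \<le> 72 * lg\<^sup>2 * S"
  proof -
    have "Y * (4 * lg * real n / \<mu>) = 24 * lg * real L * real n * (Y / real k) / real d"
      using d k by (simp add: \<mu>_def field_simps)
    also have "\<dots> = 24 * lg * real L * real n * (q * q) / real d"
      unfolding qq Y_def ..
    also have "\<dots> \<le> 24 * lg * real L * real n * (q * q) / q"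
      using d q lg by (intro divide_left_mono) auto
    also have "\<dots> = 24 * lg * real L * S" using q by (simp add: nq[symmetric])
    also have "\<dots> \<le> 24 * lg * (3 * lg) * S" using L_le lg S_pos by (intro mult_right_mono mult_left_mono) auto
    finally show ?thesis by (simp add: power2_eq_square)
  qed
  then have YR: "Y * real R \<le> 72 * lg\<^sup>2 * S + Y"
    using mult_left_mono[OF R(2) Y(1)] by (simp add: algebra_simps)
  have "real T = 3 * Y + real n * real d + real R * (real s + 2 * Y)"
    by (simp add: T_def Y_def)
  also have "real s \<le> Y" using mult_left_mono[of 1 "real n" "real s"] n by (simp add: Y_def)
  also have "real n * real d \<le> S + Y"
    using mult_left_mono[OF d(3), of "real n"] Y(2) by (simp add: nq[symmetric] algebra_simps)
  finally have "real T \<le> 3 * Y + (S + Y) + real R * (Y + 2 * Y)"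
    by (simp add: mult_left_mono)
  also have "\<dots> \<le> 3 * Y + (S + Y) + 3 * (72 * lg\<^sup>2 * S + Y)"
    using YR by (simp add: algebra_simps)
  also have "\<dots> = S + 216 * (lg\<^sup>2 * S) + 7 * Y" by simp
  also have "\<dots> \<le> 217 * lg\<^sup>2 * (S + Y * real k)"
  proof -
    have l2: "1 \<le> lg\<^sup>2" using lg by simp
    have "S \<le> lg\<^sup>2 * S" using mult_right_mono[OF l2 S_pos] by simp
    \<comment> \<open>The factor \<open>k\<close> of the second summand enters here; the count of
      rounds so far has \<open>Y\<close> alone.\<close>
    moreover have "Y \<le> Y * real k" using Y k mult_left_mono[of 1 "real k" Y] by simp
    moreover have "Y * real k \<le> lg\<^sup>2 * (Y * real k)" using mult_right_mono[OF l2, of "Y * real k"] Y by simp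
    moreover have "0 \<le> Y * real k" using Y by simp
    ultimately show ?thesis by (simp add: algebra_simps)
  qed
  finally have T: "real T \<le> 217 * lg\<^sup>2 * (S + Y * real k)" .
  have "real (2 * (2 * L + 1) * T) = (4 * real L + 2) * real T" by (simp add: algebra_simps)
  also have "\<dots> \<le> (14 * lg) * (217 * lg\<^sup>2 * (S + Y * real k))"
    using T L_le lg by (intro mult_mono) auto
  also have "\<dots> = 3038 * lg ^ 3 * (S + Y * real k)" by (simp add: power2_eq_square power3_eq_cube)
  finally have bound: "real (2 * (2 * L + 1) * T) \<le> 3038 * lg ^ 3 * (S + Y * real k)" .
  have "ereal_of_enat (additive_spanner_cc s n k) \<le> ereal_of_enat (enat (2 * (2 * L + 1) * T))"
    using cc by (simp only: ereal_of_enat_le_iff)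
  also have "\<dots> = ereal (real (2 * (2 * L + 1) * T))" by (simp only: ereal_of_enat_simps)
  also have "\<dots> \<le> ereal (3038 * lg ^ 3 * (S + Y * real k))" using bound by (simp only: ereal_less_eq)
  finally show "ereal_of_enat (additive_spanner_cc s n k)
     \<le> ereal (3038 * log 2 (real n) ^ 3 *
          (sqrt (real s / real k) * real n powr (3 / 2) + real s * real n * real k))"
    unfolding S_def Y_def lg_def .
qed simp

end
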